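(* Let $k\ge 1$, let $\mathcal I$ be a complete marriage instance with men $m_1,\dots,m_k$ and women $w_1,\dots,w_k$, $n=2k$, and let $A,b,C$ be as in the context. For $\epsilon>0$ let $b(\epsilon)=(\epsilon^{k+1},\epsilon^{k+2},\dots,\epsilon^{2k},\epsilon,\epsilon^2,\dots,\epsilon^k)^T\in\mathbb Q^n$ (the first $k$ entries correspond to the men's rows, the last $k$ to the women's rows). Then there exists $\epsilon>0$ such that $\{x\ge 0: Ax=b+b(\epsilon)\}$ is non-degenerate and the sequence of pairs $(B_0,D_0),(B_1,D_1),\dots,(B_N,D_N)$ (feasible basis, ordinal basis) produced by Scarf's algorithm on input $(A,b+b(\epsilon),C)$ coincides with the sequence of pairs produced by an execution of Scarf's algorithm on input $(A,b,C)$ in which every cardinal pivot follows the rule below. Rule: with $B$ the current feasible basis, $D$ the current ordinal basis with utility $u$, and $j_t$ the unique element of $D\setminus B$: if $u_1\in\{k+1,\dots,k^2\}$ let $m_i$ be the separator of $D$, otherwise set $i=1$; if the loop column $i$ is a candidate to leave the basis, let it leave; otherwise let leave any column corresponding to a woman-disliked (w.r.t. $D$) valid edge that is a candidate to leave.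
   Context: Instance: men $M=\{m_1,\dots,m_k\}$, women $W=\{w_1,\dots,w_k\}$; $v_i=m_i$, $v_{k+i}=w_i$ ($i\in[k]$), $n=2k$; all preferences strict and complete. Graph: $n$ loops $e_1,\dots,e_n$ ($e_i$ at $v_i$) and $k^2$ valid edges $(m,w)$; each agent prefers every valid edge containing it to its loop. Columns indexed by $[n+k^2]$: column $j\le n$ is loop $e_j$; for $i\in[k]$ columns $n+k(i-1)+1,\dots,n+ki$ are the edges $(m_i,w)$ in decreasing order of $m_i$'s preference. $A$: $a_{ij}=1$ iff $v_i\in e_j$, else $0$; $b=(1,\dots,1)^T$. $C=(c_{ij})$: if $v_i\in e_j$ and $e_j$ is the $\ell$-th best of the $k+1$ edges containing $v_i$ (loop last), $c_{ij}=k+1-\ell$; if $e_j$ is a valid edge not containing $v_i$, $c_{ij}\in\{k+1,\dots,k^2\}$ assigned in decreasing order from left to right; if $e_j$ is a loop with $j\ne i$, $c_{ij}\in\{k^2+1,\dots,k^2+2k-1\}$ assigned in decreasing order from left to right. For right-hand side $\beta$, a feasible basis is a set $B$ of $n$ linearly independent columns with $A_B^{-1}\beta\ge 0$; the polytope is non-degenerate if every feasible basis has $A_B^{-1}\beta>0$ (then every cardinal pivot is uniquely determined). Ordinal basis: $n$ columns $D$ such that, with $u_i=\min_{j\in D}c_{ij}$, every column $h$ has some $i$ with $u_i\ge c_{ih}$; for each row $i$ there is a unique $j\in D$ with $c_{ij}=u_i$, and $e_j$ is called $v_i$-disliked (w.r.t. $D$); man-/woman-disliked means disliked by some man/woman.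 Separator of $D$ (when $u_1\in\{k+1,\dots,k^2\}$): the man $m_i$ with $i$ the smallest index in $\{2,\dots,k\}$ such that column $i$ is in $D$. A column $j_\ell\in B$ is a candidate to leave if $B\setminus\{j_\ell\}\cup\{j_t\}$ is a feasible basis. Scarf's algorithm on $(A,\beta,C)$: start with $B=\{1,\dots,n\}$, $D=\{j_0,2,\dots,n\}$, $j_0$ maximizing $c_{1j}$ over $j>n$. While $B\ne D$: with $\{j_t\}=D\setminus B$, a cardinal pivot replaces $B$ by $B\setminus\{j_\ell\}\cup\{j_t\}$ for a candidate $j_\ell$; if then $B\ne D$, an ordinal pivot replaces $D$ by $D\setminus\{j_\ell\}\cup\{j^*\}$ with $j^*\notin D$ the unique column making it an ordinal basis. The sequence of pairs $(B,D)$ after each iteration is recorded.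
   Formalization: If neither loop i nor any woman-disliked valid edge is a candidate (as happens for k=2 when both men rank the same woman first), the rule as stated allows no pivot; in that case only, the rule proved here lets a woman-disliked candidate that is a loop leave. *)

theory Defs
  imports Complex_Main
begin

text \<open>
  Matrices are functions of a row index in \<open>{1..n}\<close> and a column index in \<open>{1..N}\<close>;
  vectors are functions of the index. Both \<open>n\<close> and \<open>N\<close> depend on the size of the instance.
\<close>

definition lin_indep_cols :: "nat \<Rightarrow> (nat \<Rightarrow> nat \<Rightarrow> real) \<Rightarrow> nat set \<Rightarrow> bool" where
  "lin_indep_cols n A B \<longleftrightarrow>
     (\<forall>y. (\<forall>i\<in>{1..n}. (\<Sum>j\<in>B. A i j * y j) = 0) \<longrightarrow> (\<forall>j\<in>B. y j = 0))"

text \<open>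
  The vector $A_B^{-1}\beta$, indexed by the columns in \<open>B\<close> and extended by \<open>0\<close>. The description
  is proper when \<open>B\<close> consists of \<open>n\<close> linearly independent columns, the only case of interest.
\<close>

definition basic_sol ::
  "nat \<Rightarrow> (nat \<Rightarrow> nat \<Rightarrow> real) \<Rightarrow> (nat \<Rightarrow> real) \<Rightarrow> nat set \<Rightarrow> nat \<Rightarrow> real" where
  "basic_sol n A \<beta> B =
     (THE x. (\<forall>i\<in>{1..n}. (\<Sum>j\<in>B. A i j * x j) = \<beta> i) \<and> (\<forall>j. j \<notin> B \<longrightarrow> x j = 0))"

definition feasible_basis ::
  "nat \<Rightarrow> nat \<Rightarrow> (nat \<Rightarrow> nat \<Rightarrow> real) \<Rightarrow> (nat \<Rightarrow> real) \<Rightarrow> nat set \<Rightarrow> bool" where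
  "feasible_basis n N A \<beta> B \<longleftrightarrow>
     B \<subseteq> {1..N} \<and> card B = n \<and> lin_indep_cols n A B \<and> (\<forall>j\<in>B. basic_sol n A \<beta> B j \<ge> 0)"

definition nondegenerate ::
  "nat \<Rightarrow> nat \<Rightarrow> (nat \<Rightarrow> nat \<Rightarrow> real) \<Rightarrow> (nat \<Rightarrow> real) \<Rightarrow> bool" where
  "nondegenerate n N A \<beta> \<longleftrightarrow>
     (\<forall>B. feasible_basis n N A \<beta> B \<longrightarrow> (\<forall>j\<in>B. basic_sol n A \<beta> B j > 0))"

definition utility :: "(nat \<Rightarrow> nat \<Rightarrow> nat) \<Rightarrow> nat set \<Rightarrow> nat \<Rightarrow> nat" where
  "utility C D i = Min (C i ` D)"

definition ordinal_basis :: "nat \<Rightarrow> nat \<Rightarrow> (nat \<Rightarrow> nat \<Rightarrow> nat) \<Rightarrow> nat set \<Rightarrow> bool" where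
  "ordinal_basis n N C D \<longleftrightarrow>
     D \<subseteq> {1..N} \<and> card D = n \<and> (\<forall>h\<in>{1..N}. \<exists>i\<in>{1..n}. utility C D i \<ge> C i h)"

definition disliked :: "(nat \<Rightarrow> nat \<Rightarrow> nat) \<Rightarrow> nat set \<Rightarrow> nat \<Rightarrow> nat \<Rightarrow> bool" where
  "disliked C D i j \<longleftrightarrow> j \<in> D \<and> C i j = utility C D i"

definition candidate ::
  "nat \<Rightarrow> nat \<Rightarrow> (nat \<Rightarrow> nat \<Rightarrow> real) \<Rightarrow> (nat \<Rightarrow> real) \<Rightarrow> nat set \<Rightarrow> nat \<Rightarrow> nat \<Rightarrow> bool" where
  "candidate n N A \<beta> B jt jl \<longleftrightarrow> jl \<in> B \<and> feasible_basis n N A \<beta> (insert jt (B - {jl}))"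

text \<open>
  A pivot rule \<open>R B D jt jl\<close> says whether the candidate column \<open>jl\<close> is allowed to leave \<open>B\<close>
  when \<open>jt\<close> enters.
\<close>

type_synonym pivot_rule = "nat set \<Rightarrow> nat set \<Rightarrow> nat \<Rightarrow> nat \<Rightarrow> bool"

definition any_candidate :: pivot_rule where
  "any_candidate B D jt jl \<longleftrightarrow> True"

definition scarf_init ::
  "nat \<Rightarrow> nat \<Rightarrow> (nat \<Rightarrow> nat \<Rightarrow> nat) \<Rightarrow> nat set \<times> nat set \<Rightarrow> bool" where
  "scarf_init n N C = (\<lambda>(B, D). B = {1..n} \<and>
     (\<exists>j0\<in>{n<..N}. (\<forall>j\<in>{n<..N}. C 1 j \<le> C 1 j0) \<and> D = insert j0 {2..n}))"

definition scarf_iteration ::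
  "pivot_rule \<Rightarrow> nat \<Rightarrow> nat \<Rightarrow> (nat \<Rightarrow> nat \<Rightarrow> real) \<Rightarrow> (nat \<Rightarrow> real) \<Rightarrow> (nat \<Rightarrow> nat \<Rightarrow> nat) \<Rightarrow>
     nat set \<times> nat set \<Rightarrow> nat set \<times> nat set \<Rightarrow> bool" where
  "scarf_iteration R n N A \<beta> C = (\<lambda>(B, D) (B', D').
     B \<noteq> D \<and>
     (\<exists>jt jl. D - B = {jt} \<and> candidate n N A \<beta> B jt jl \<and> R B D jt jl \<and>
        B' = insert jt (B - {jl}) \<and>
        (if B' = D then D' = D
         else (\<exists>js. {j \<in> {1..N} - D. ordinal_basis n N C (insert j (D - {jl}))} = {js} \<and>
                 D' = insert js (D - {jl})))))"

text \<open>
  The complete record \<open>(B 0, D 0), \<dots>, (B N, D N)\<close> of a terminating execution: the initial pair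
  followed by the pair after each iteration, up to the first pair with \<open>B = D\<close>.
\<close>

definition scarf_execution ::
  "pivot_rule \<Rightarrow> nat \<Rightarrow> nat \<Rightarrow> (nat \<Rightarrow> nat \<Rightarrow> real) \<Rightarrow> (nat \<Rightarrow> real) \<Rightarrow> (nat \<Rightarrow> nat \<Rightarrow> nat) \<Rightarrow>
     (nat set \<times> nat set) list \<Rightarrow> bool" where
  "scarf_execution R n N A \<beta> C s \<longleftrightarrow>
     s \<noteq> [] \<and> scarf_init n N C (hd s) \<and>
     (\<forall>t. Suc t < length s \<longrightarrow> scarf_iteration R n N A \<beta> C (s ! t) (s ! Suc t)) \<and>
     fst (last s) = snd (last s)"


text \<open>
  A complete marriage instance with \<open>k\<close> men and \<open>k\<close> women: \<open>mp i\<close> lists the indices of all women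
  in decreasing order of the preference of $m_i$, and \<open>wp j\<close> those of all men in decreasing
  order of the preference of $w_j$.
\<close>

definition complete_marriage_instance ::
  "nat \<Rightarrow> (nat \<Rightarrow> nat list) \<Rightarrow> (nat \<Rightarrow> nat list) \<Rightarrow> bool" where
  "complete_marriage_instance k mp wp \<longleftrightarrow>
     (\<forall>i\<in>{1..k}. distinct (mp i) \<and> set (mp i) = {1..k}) \<and>
     (\<forall>j\<in>{1..k}. distinct (wp j) \<and> set (wp j) = {1..k})"

text \<open>
  \<open>Loop i\<close> is the loop at $v_i$, and \<open>Valid i j\<close> is the edge $(m_i, w_j) = (v_i, v_{k+j})$.
\<close>

datatype edge = Loop nat | Valid nat nat

fun ends :: "nat \<Rightarrow> edge \<Rightarrow> nat set" where
  "ends k (Loop i) = {i}"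
| "ends k (Valid i j) = {i, k + j}"

fun is_valid :: "edge \<Rightarrow> bool" where
  "is_valid (Loop i) = False"
| "is_valid (Valid i j) = True"

definition column_edges :: "nat \<Rightarrow> (nat \<Rightarrow> nat list) \<Rightarrow> edge list" where
  "column_edges k mp =
     map Loop [1..<2*k+1] @ concat (map (\<lambda>i. map (Valid i) (mp i)) [1..<k+1])"

definition col_edge :: "nat \<Rightarrow> (nat \<Rightarrow> nat list) \<Rightarrow> nat \<Rightarrow> edge" where
  "col_edge k mp j = column_edges k mp ! (j - 1)"

text \<open>The \<open>k + 1\<close> edges containing $v_i$, from the best to the worst.\<close>

definition edge_prefs ::
  "nat \<Rightarrow> (nat \<Rightarrow> nat list) \<Rightarrow> (nat \<Rightarrow> nat list) \<Rightarrow> nat \<Rightarrow> edge list" where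
  "edge_prefs k mp wp i =
     (if i \<le> k then map (\<lambda>w. Valid i w) (mp i)
      else map (\<lambda>m. Valid m (i - k)) (wp (i - k))) @ [Loop i]"

text \<open>\<open>edge_rank k mp wp i e = l\<close> if \<open>e\<close> is the \<open>l\<close>-th best edge containing $v_i$ (from \<open>1\<close> on).\<close>

definition edge_rank ::
  "nat \<Rightarrow> (nat \<Rightarrow> nat list) \<Rightarrow> (nat \<Rightarrow> nat list) \<Rightarrow> nat \<Rightarrow> edge \<Rightarrow> nat" where
  "edge_rank k mp wp i e = Suc (length (takeWhile (\<lambda>e'. e' \<noteq> e) (edge_prefs k mp wp i)))"

definition matrix_A :: "nat \<Rightarrow> (nat \<Rightarrow> nat list) \<Rightarrow> nat \<Rightarrow> nat \<Rightarrow> real" where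
  "matrix_A k mp i j = (if i \<in> ends k (col_edge k mp j) then 1 else 0)"

text \<open>
  In row \<open>i\<close> the $k^2 - k$ valid edges not containing $v_i$ receive the values
  $k^2, \dots, k + 1$ and the $2k - 1$ other loops the values $k^2 + 2k - 1, \dots, k^2 + 1$,
  both from left to right. So the offset of a column is the number of columns of its kind that
  are not to its left.
\<close>

definition matrix_C ::
  "nat \<Rightarrow> (nat \<Rightarrow> nat list) \<Rightarrow> (nat \<Rightarrow> nat list) \<Rightarrow> nat \<Rightarrow> nat \<Rightarrow> nat" where
  "matrix_C k mp wp i j =
     (let e = col_edge k mp j in
      if i \<in> ends k e then k + 1 - edge_rank k mp wp i e
      else if is_valid e then
        k + card {j' \<in> {j..2*k + k^2}. is_valid (col_edge k mp j') \<and> i \<notin> ends k (col_edge k mp j')}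
      else k^2 + card {j' \<in> {j..2*k}. j' \<noteq> i})"

definition rhs_b :: "nat \<Rightarrow> real" where
  "rhs_b i = 1"

definition perturbation :: "nat \<Rightarrow> real \<Rightarrow> nat \<Rightarrow> real" where
  "perturbation k \<epsilon> i = (if i \<le> k then \<epsilon> ^ (k + i) else \<epsilon> ^ (i - k))"

definition is_separator :: "nat \<Rightarrow> nat set \<Rightarrow> nat \<Rightarrow> bool" where
  "is_separator k D i \<longleftrightarrow> i \<in> {2..k} \<and> i \<in> D \<and> (\<forall>i'\<in>{2..k}. i' \<in> D \<longrightarrow> i \<le> i')"

definition woman_disliked ::
  "nat \<Rightarrow> (nat \<Rightarrow> nat \<Rightarrow> nat) \<Rightarrow> nat set \<Rightarrow> nat \<Rightarrow> bool" where
  "woman_disliked k C D j \<longleftrightarrow> (\<exists>i\<in>{k+1..2*k}. disliked C D i j)"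

text \<open>
  The column \<open>jl\<close> chosen to leave when \<open>jt\<close> enters. It may happen that the loop \<open>i\<close> is not a
  candidate and that there is no candidate among the woman-disliked valid edges either: for
  \<open>k = 2\<close>, if both men rank $w_1$ first, then after one iteration the only candidate is the loop
  of $w_1$, which $w_1$ dislikes. In this case, and only then, the rule lets a candidate leave
  that is woman-disliked without being a valid edge.
\<close>

definition separator_rule :: "nat \<Rightarrow> (nat \<Rightarrow> nat list) \<Rightarrow> (nat \<Rightarrow> nat list) \<Rightarrow> pivot_rule" where
  "separator_rule k mp wp B D jt jl \<longleftrightarrow>
     (let C = matrix_C k mp wp;
          cand = candidate (2*k) (2*k + k^2) (matrix_A k mp) rhs_b B jt;
          valid = (\<lambda>j. is_valid (col_edge k mp j))
      in \<exists>i. (if utility C D 1 \<in> {k+1..k^2} then is_separator k D i else i = 1) \<and>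
             (if cand i then jl = i
              else if \<exists>j. cand j \<and> valid j \<and> woman_disliked k C D j
              then cand jl \<and> valid jl \<and> woman_disliked k C D jl
              else cand jl \<and> woman_disliked k C D jl))"

end

theory Submission
  imports Defs
begin

text \<open>
  The entries of the basic solution of a basis are alternating sums of the right-hand side over sets
  of agents, so with \<open>\<epsilon> = 1 / (k + 1)\<close> the perturbation decides only the sign of the balanced sums,
  and there the women win. Hence the perturbed polytope is non-degenerate, perturbed pivots are
  pivots of the original system, and the loop of a man never has value \<open>0\<close>.

  During the execution the entering column is a valid edge disliked by a man. The assignment of
  disliked columns to agents turns the pivot direction into a nonnegative flow whose source is the
  loop of the separator (or of the first man); so only this loop and woman-disliked columns can
  decrease. Every iteration raises the utility of a woman or lowers that of the first man, without
  changing any of these utilities in the other direction, which gives termination.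
\<close>

section \<open>Bases and pivots\<close>

text \<open>The delicate point is tie-breaking: in the original system several columns may reach 0
  in the same pivot, the perturbation selects one of them, and the rule must agree with this choice.
  The tool is a certificate. If column \<open>j\<close> of a basis feasible for \<open>bp\<close>
  has value 0 in the original system, then some set of agents, men counted +1 and women -1, has
  signed sum -1 at \<open>j\<close> and 0 at every other basic column. The sign is fixed because the
  women win the balanced sums; it breaks the symmetry between the two sides. A man's loop has signed
  sum 0 or +1, so it is never the zero column, and as a candidate it always leaves. A woman's loop
  has signed sum 0 or -1, and pairing the certificate with the pivot direction shows that she can
  leave by her loop only if no other decreasing column is a candidate. This is what the order of the
  cases in \<open>separator_rule\<close> requires.\<close>

lemma homogeneous_nontrivial_solution:
  fixes a :: "'i \<Rightarrow> 'j \<Rightarrow> real"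
  assumes "finite I" "finite J" "card I < card J"
  shows "\<exists>y. (\<exists>j\<in>J. y j \<noteq> 0) \<and> (\<forall>i\<in>I. (\<Sum>j\<in>J. a i j * y j) = 0)"
  using assms
proof (induction I arbitrary: J a rule: finite_induct)
  case empty
  then obtain j where "j \<in> J" by (metis card.empty card_gt_0_iff ex_in_conv)
  then show ?case by (intro exI[of _ "\<lambda>_. 1"]) auto
next
  case (insert r I)
  show ?case
  proof (cases "\<forall>j\<in>J. a r j = 0")
    case True
    have "card I < card J" using insert by simp
    then obtain y where "\<exists>j\<in>J. y j \<noteq> 0" "\<forall>i\<in>I. (\<Sum>j\<in>J. a i j * y j) = 0"
      using insert.IH[of J a] insert.prems by blast
    then show ?thesis using True by (intro exI[of _ y]) auto
  next
    case False
    then obtain p where p: "p \<in> J" "a r p \<noteq> 0" by blast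
    \<comment> \<open>Gaussian elimination: row \<open>r\<close> clears column \<open>p\<close> from
      the other rows, and back substitution in row \<open>r\<close> later recovers the value
      \<open>t\<close> at \<open>p\<close>.\<close>
    define a' where "a' i j = a i j - a i p * a r j / a r p" for i j
    have "card I < card (J - {p})" using insert p by (simp add: card_Diff_singleton)
    then obtain y where y: "\<exists>j\<in>J - {p}. y j \<noteq> 0"
        "\<forall>i\<in>I. (\<Sum>j\<in>J - {p}. a' i j * y j) = 0"
      using insert.IH[of "J - {p}" a'] insert.prems by blast
    define t where "t = - (\<Sum>j\<in>J - {p}. a r j * y j) / a r p"
    define y' where "y' = y(p := t)"
    have S: "(\<Sum>j\<in>J. a i j * y' j) = a i p * t + (\<Sum>j\<in>J - {p}. a i j * y j)" for i
    proof -
      have "(\<Sum>j\<in>J. a i j * y' j) = a i p * y' p + (\<Sum>j\<in>J - {p}. a i j * y' j)"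
        using p insert.prems by (simp add: sum.remove)
      also have "(\<Sum>j\<in>J - {p}. a i j * y' j) = (\<Sum>j\<in>J - {p}. a i j * y j)"
        by (rule sum.cong) (auto simp: y'_def)
      finally show ?thesis by (simp add: y'_def)
    qed
    have "(\<Sum>j\<in>J. a i j * y' j) = 0" if "i \<in> insert r I" for i
    proof (cases "i = r")
      case True
      then show ?thesis using p by (simp add: S t_def)
    next
      case False
      then have "0 = (\<Sum>j\<in>J - {p}. a' i j * y j)" using y that by simp
      also have "\<dots> = (\<Sum>j\<in>J - {p}. a i j * y j - a i p / a r p * (a r j * y j))"
        by (rule sum.cong) (auto simp: a'_def algebra_simps)
      also have "\<dots> = (\<Sum>j\<in>J - {p}. a i j * y j)
          - a i p / a r p * (\<Sum>j\<in>J - {p}. a r j * y j)"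
        by (simp add: sum_subtractf sum_distrib_left)
      finally show ?thesis by (simp add: S t_def)
    qed
    moreover have "\<exists>j\<in>J. y' j \<noteq> 0" using y by (auto simp: y'_def)
    ultimately show ?thesis by blast
  qed
qed

text \<open>Vanishing outside \<open>B\<close> makes solutions unique as functions and lets one
  vector be read over nested column sets, which is how bases before and after a pivot are
  compared.\<close>

definition solves ::
  "nat \<Rightarrow> (nat \<Rightarrow> nat \<Rightarrow> real) \<Rightarrow> (nat \<Rightarrow> real) \<Rightarrow> nat set \<Rightarrow> (nat \<Rightarrow> real) \<Rightarrow> bool" where
  "solves n A \<beta> B x \<longleftrightarrow>
     (\<forall>i\<in>{1..n}. (\<Sum>j\<in>B. A i j * x j) = \<beta> i) \<and> (\<forall>j. j \<notin> B \<longrightarrow> x j = 0)"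

lemma solves_supset:
  assumes "solves n A \<beta> B x" "B \<subseteq> B'" "finite B'"
  shows "solves n A \<beta> B' x"
proof -
  have "(\<Sum>j\<in>B'. A i j * x j) = (\<Sum>j\<in>B. A i j * x j)" for i
    using assms by (intro sum.mono_neutral_right) (auto simp: solves_def)
  then show ?thesis using assms by (auto simp: solves_def)
qed

lemma solves_subset:
  assumes "solves n A \<beta> B' x" "B \<subseteq> B'" "finite B'" "\<And>j. j \<in> B' - B \<Longrightarrow> x j = 0"
  shows "solves n A \<beta> B x"
proof -
  have "(\<Sum>j\<in>B'. A i j * x j) = (\<Sum>j\<in>B. A i j * x j)" for i
    using assms by (intro sum.mono_neutral_right) (auto simp: solves_def)
  moreover have "x j = 0" if "j \<notin> B" for j
    using assms that by (cases "j \<in> B'") (auto simp: solves_def)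
  ultimately show ?thesis using assms by (auto simp: solves_def)
qed

lemma solves_add_scaled:
  assumes "solves n A \<beta> B x" "solves n A \<gamma> B y"
  shows "solves n A (\<lambda>i. \<beta> i + c * \<gamma> i) B (\<lambda>j. x j + c * y j)"
proof -
  have "(\<Sum>j\<in>B. A i j * (x j + c * y j)) = (\<Sum>j\<in>B. A i j * x j) + c * (\<Sum>j\<in>B. A i j * y j)" for i
    by (simp add: algebra_simps sum.distrib sum_distrib_left)
  then show ?thesis using assms by (auto simp: solves_def)
qed

lemma lin_indep_cols_solves_zero:
  assumes "lin_indep_cols n A B" "solves n A (\<lambda>_. 0) B y"
  shows "y j = 0"
  using assms unfolding lin_indep_cols_def solves_def by (cases "j \<in> B") auto

lemma lin_indep_colsI:
  assumes "\<And>y. solves n A (\<lambda>_. 0) B y \<Longrightarrow> \<forall>j\<in>B. y j = 0"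
  shows "lin_indep_cols n A B"
  unfolding lin_indep_cols_def
proof (intro allI impI)
  fix y assume y: "\<forall>i\<in>{1..n}. (\<Sum>j\<in>B. A i j * y j) = 0"
  define y' where "y' j = (if j \<in> B then y j else 0)" for j
  have "(\<Sum>j\<in>B. A i j * y' j) = (\<Sum>j\<in>B. A i j * y j)" for i
    by (rule sum.cong) (auto simp: y'_def)
  then have "solves n A (\<lambda>_. 0) B y'" using y by (simp add: solves_def y'_def)
  then show "\<forall>j\<in>B. y j = 0" using assms[of y'] by (simp add: y'_def)
qed

lemma solves_unique:
  assumes "lin_indep_cols n A B" "solves n A \<beta> B x" "solves n A \<beta> B y"
  shows "x = y"
proof
  fix j
  have "solves n A (\<lambda>i. \<beta> i + (-1) * \<beta> i) B (\<lambda>j. x j + (-1) * y j)"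
    using assms(2,3) by (rule solves_add_scaled)
  then have "x j + (-1) * y j = 0"
    using lin_indep_cols_solves_zero[OF assms(1), of "\<lambda>j. x j + (-1) * y j" j] by simp
  then show "x j = y j" by simp
qed

text \<open>The right-hand side is adjoined to \<open>B\<close> as an additional column
  \<open>None\<close>. There are then more unknowns than equations, and independence of
  \<open>B\<close> forces a nonzero coefficient at \<open>None\<close>, by which one
  divides.\<close>

lemma solves_exists:
  assumes "lin_indep_cols n A B" "finite B" "card B = n"
  shows "\<exists>x. solves n A \<beta> B x"
proof -
  define a where "a i o' = (case o' of None \<Rightarrow> \<beta> i | Some j \<Rightarrow> A i j)" for i :: nat and o'
  let ?J = "insert None (Some ` B)"
  have "card ?J = Suc n" using assms by (simp add: card_image)
  then obtain y where y: "\<exists>j\<in>?J. y j \<noteq> 0" "\<forall>i\<in>{1..n}. (\<Sum>j\<in>?J. a i j * y j) = 0"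
    using homogeneous_nontrivial_solution[of "{1..n}" ?J a] assms by auto
  have S: "(\<Sum>j\<in>?J. a i j * y j) = \<beta> i * y None + (\<Sum>j\<in>B. A i j * y (Some j))" for i
    using assms by (simp add: sum.reindex a_def)
  have N: "y None \<noteq> 0"
  proof
    assume z: "y None = 0"
    then have "\<forall>i\<in>{1..n}. (\<Sum>j\<in>B. A i j * y (Some j)) = 0" using y(2) S by simp
    then have "\<forall>j\<in>B. y (Some j) = 0"
      using assms(1)[unfolded lin_indep_cols_def, rule_format, of "\<lambda>j. y (Some j)"] by blast
    then show False using y(1) z by auto
  qed
  define x where "x j = (if j \<in> B then - y (Some j) / y None else 0)" for j
  have "(\<Sum>j\<in>B. A i j * x j) = \<beta> i" if "i \<in> {1..n}" for i
  proof -
    have "(\<Sum>j\<in>B. A i j * x j) = (\<Sum>j\<in>B. - (A i j * y (Some j)) / y None)"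
      by (rule sum.cong) (auto simp: x_def)
    also have "\<dots> = - (\<Sum>j\<in>B. A i j * y (Some j)) / y None"
      by (simp add: sum_divide_distrib[symmetric] sum_negf)
    also have "\<dots> = \<beta> i" using y(2) S[of i] that N by (simp add: field_simps)
    finally show ?thesis .
  qed
  then show ?thesis unfolding solves_def by (intro exI[of _ x]) (auto simp: x_def)
qed

lemma basic_sol_solves:
  assumes "lin_indep_cols n A B" "finite B" "card B = n"
  shows "solves n A \<beta> B (basic_sol n A \<beta> B)"
proof -
  have "\<exists>!x. solves n A \<beta> B x"
    using solves_exists[OF assms, of \<beta>] solves_unique[OF assms(1)] by blast
  then show ?thesis unfolding basic_sol_def solves_def by (rule theI')
qed

lemma basic_sol_eqI:
  assumes "lin_indep_cols n A B" "finite B" "card B = n" "solves n A \<beta> B x"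
  shows "basic_sol n A \<beta> B = x"
  using solves_unique[OF assms(1) basic_sol_solves[OF assms(1-3)] assms(4)] .

lemma sum_left_mult_solves:
  assumes "solves n A \<beta> B x" "S \<subseteq> {1..n}"
  shows "(\<Sum>i\<in>S. z i * \<beta> i) = (\<Sum>j\<in>B. (\<Sum>i\<in>S. z i * A i j) * x j)"
proof -
  have "(\<Sum>i\<in>S. z i * \<beta> i) = (\<Sum>i\<in>S. z i * (\<Sum>j\<in>B. A i j * x j))"
    using assms by (intro sum.cong) (auto simp: solves_def)
  also have "\<dots> = (\<Sum>i\<in>S. \<Sum>j\<in>B. z i * A i j * x j)" by (simp add: sum_distrib_left mult_ac)
  also have "\<dots> = (\<Sum>j\<in>B. \<Sum>i\<in>S. z i * A i j * x j)" by (rule sum.swap)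
  finally show ?thesis by (simp add: sum_distrib_right)
qed

text \<open>Orthogonality to the columns other than \<open>j\<close> is a homogeneous system with
  one equation less than unknowns. It remains to scale a solution to the value 1 at
  \<open>j\<close>.\<close>

lemma dual_row_exists:
  assumes "lin_indep_cols n A B" "finite B" "card B = n" "j \<in> B"
  shows "\<exists>z. \<forall>h\<in>B. (\<Sum>i\<in>{1..n}. z i * A i h) = of_bool (h = j)"
proof -
  have "card (B - {j}) < card {1..n}" using assms card_Diff1_less[of B j] by simp
  then obtain z where z: "\<exists>i\<in>{1..n}. z i \<noteq> 0"
      "\<forall>h\<in>B - {j}. (\<Sum>i\<in>{1..n}. A i h * z i) = 0"
    using homogeneous_nontrivial_solution[of "B - {j}" "{1..n}" "\<lambda>h i. A i h"] assms by auto
  define q where "q = (\<Sum>i\<in>{1..n}. z i * A i j)"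
  have q: "q \<noteq> 0"
  proof
    assume "q = 0"
    then have k: "\<forall>h\<in>B. (\<Sum>i\<in>{1..n}. z i * A i h) = 0" using z(2) q_def by (auto simp: mult_ac)
    \<comment> \<open>The columns of \<open>B\<close> span everything, in particular
      \<open>z\<close> itself; if \<open>z\<close> were orthogonal to all of them, it would be
      orthogonal to itself.\<close>
    obtain x where "solves n A z B x" using solves_exists[OF assms(1-3)] by blast
    from sum_left_mult_solves[OF this, of "{1..n}" z] k
    have "(\<Sum>i\<in>{1..n}. z i * z i) = 0" by simp
    then have "\<forall>i\<in>{1..n}. z i * z i = 0" by (subst (asm) sum_nonneg_eq_0_iff) auto
    then show False using z(1) by auto
  qed
  have "(\<Sum>i\<in>{1..n}. z i / q * A i h) = of_bool (h = j)" if "h \<in> B" for h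
  proof -
    have "(\<Sum>i\<in>{1..n}. z i / q * A i h) = (\<Sum>i\<in>{1..n}. z i * A i h) / q"
      by (simp add: sum_divide_distrib)
    then show ?thesis using q z(2) that q_def by (auto simp: mult_ac)
  qed
  then show ?thesis by (intro exI[of _ "\<lambda>i. z i / q"]) blast
qed

text \<open>The direction in which the basic variables move when \<open>jt\<close> is raised at unit
  rate.\<close>

lemma pivot_direction_exists:
  assumes "lin_indep_cols n A B" "finite B" "card B = n" "jt \<notin> B"
  shows "\<exists>v. solves n A (\<lambda>_. 0) (insert jt B) v \<and> v jt = 1"
proof -
  obtain x where x: "solves n A (\<lambda>i. - A i jt) B x" using solves_exists[OF assms(1-3)] by blast
  have "(\<Sum>j\<in>B. A i j * (x(jt := 1)) j) = (\<Sum>j\<in>B. A i j * x j)" for i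
    using assms by (intro sum.cong) auto
  then have "solves n A (\<lambda>_. 0) (insert jt B) (x(jt := 1))"
    using x assms by (auto simp: solves_def)
  then show ?thesis by (intro exI[of _ "x(jt := 1)"]) auto
qed

lemma solves_on_line:
  assumes "lin_indep_cols n A B" "finite B" "jt \<notin> B"
    and "solves n A (\<lambda>_. 0) (insert jt B) v" "v jt = 1"
    and "solves n A \<beta> B x" "solves n A \<beta> (insert jt B) x'"
  shows "x' j = x j + x' jt * v j"
proof -
  have 1: "solves n A \<beta> (insert jt B) x" using assms by (auto intro: solves_supset)
  have "solves n A (\<lambda>i. \<beta> i + x' jt * 0) (insert jt B) (\<lambda>j. x j + x' jt * v j)"
    by (rule solves_add_scaled[OF 1 assms(4)])
  then have 2: "solves n A \<beta> (insert jt B) (\<lambda>j. x j + x' jt * v j)" by simp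
  have "solves n A (\<lambda>i. \<beta> i + (-1) * \<beta> i) (insert jt B)
      (\<lambda>j. x' j + (-1) * (x j + x' jt * v j))"
    by (rule solves_add_scaled[OF assms(7) 2])
  then have "solves n A (\<lambda>_. 0) (insert jt B) (\<lambda>j. x' j - (x j + x' jt * v j))"
    by (simp add: algebra_simps)
  moreover have "x jt = 0" using assms by (simp add: solves_def)
  ultimately have "solves n A (\<lambda>_. 0) B (\<lambda>j. x' j - (x j + x' jt * v j))"
    using assms by (elim solves_subset) auto
  then have "x' j - (x j + x' jt * v j) = 0"
    using lin_indep_cols_solves_zero[OF assms(1), of "\<lambda>j. x' j - (x j + x' jt * v j)" j] by simp
  then show ?thesis by simp
qed

text \<open>The kernel on \<open>insert jt B\<close> is spanned by \<open>v\<close>, so removing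
  \<open>jl\<close> kills it exactly when \<open>v\<close> is nonzero there.\<close>

lemma exchange_lin_indep_iff:
  assumes "lin_indep_cols n A B" "finite B" "jt \<notin> B" "jl \<in> B"
    and "solves n A (\<lambda>_. 0) (insert jt B) v" "v jt = 1"
  shows "lin_indep_cols n A (insert jt (B - {jl})) \<longleftrightarrow> v jl \<noteq> 0"
proof
  assume L: "lin_indep_cols n A (insert jt (B - {jl}))"
  show "v jl \<noteq> 0"
  proof
    assume "v jl = 0"
    then have "solves n A (\<lambda>_. 0) (insert jt (B - {jl})) v"
      using assms by (intro solves_subset[OF assms(5)]) auto
    then show False using lin_indep_cols_solves_zero[OF L, of v jt] assms by simp
  qed
next
  assume v: "v jl \<noteq> 0"
  show "lin_indep_cols n A (insert jt (B - {jl}))"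
  proof (rule lin_indep_colsI)
    fix y assume y: "solves n A (\<lambda>_. 0) (insert jt (B - {jl})) y"
    then have y': "solves n A (\<lambda>_. 0) (insert jt B) y" using assms by (elim solves_supset) auto
    have "solves n A (\<lambda>_. 0) B (\<lambda>_. 0)" by (simp add: solves_def)
    then have e: "y j = y jt * v j" for j
      using solves_on_line[OF assms(1-3,5,6) _ y', of "\<lambda>_. 0" j] by simp
    have "y jl = 0" using y assms(3,4) by (auto simp: solves_def)
    then have "y jt = 0" using e[of jl] v by simp
    then show "\<forall>j\<in>insert jt (B - {jl}). y j = 0" using e by (metis mult_zero_left)
  qed
qed

section \<open>Feasible bases and the ratio test\<close>

lemma feasible_basis_solves:
  assumes "feasible_basis n N A \<beta> B"
  shows "solves n A \<beta> B (basic_sol n A \<beta> B)"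
proof -
  have "finite B" using assms finite_subset[of B "{1..N}"] by (simp add: feasible_basis_def)
  then show ?thesis using assms basic_sol_solves by (simp add: feasible_basis_def)
qed

lemma feasible_basisI:
  assumes "B \<subseteq> {1..N}" "card B = n" "lin_indep_cols n A B" "solves n A \<beta> B x"
    and "\<And>j. j \<in> B \<Longrightarrow> x j \<ge> 0"
  shows "feasible_basis n N A \<beta> B"
proof -
  have "finite B" using assms(1) by (rule finite_subset) simp
  then have "basic_sol n A \<beta> B = x" using basic_sol_eqI[OF assms(3) _ assms(2,4)] by blast
  then show ?thesis using assms by (simp add: feasible_basis_def)
qed

text \<open>Ratio test: \<open>r j\<close> is the distance along \<open>v\<close> at which a
  decreasing column \<open>j\<close> reaches 0, and a column of least ratio can leave without making
  any other negative.\<close>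

lemma candidate_exists:
  assumes B: "feasible_basis n N A \<beta> B" and jt: "jt \<in> {1..N}" "jt \<notin> B"
    and v: "solves n A (\<lambda>_. 0) (insert jt B) v" "v jt = 1"
    and neg: "\<exists>j\<in>B. v j < 0"
  shows "\<exists>jl. candidate n N A \<beta> B jt jl"
proof -
  let ?x = "basic_sol n A \<beta> B"
  have fB: "finite B" using B finite_subset[of B "{1..N}"] by (simp add: feasible_basis_def)
  have li: "lin_indep_cols n A B" and cB: "card B = n" and sB: "B \<subseteq> {1..N}"
    and x0: "\<And>j. j \<in> B \<Longrightarrow> ?x j \<ge> 0"
    using B unfolding feasible_basis_def by auto
  let ?P = "{j\<in>B. v j < 0}"
  define r where "r j = ?x j / (- v j)" for j
  define jl where "jl = arg_min_on r ?P"
  have P: "finite ?P" "?P \<noteq> {}" using fB neg by auto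
  have jl: "jl \<in> B" "v jl < 0" using arg_min_if_finite(1)[OF P, of r] by (auto simp: jl_def)
  have mn: "r jl \<le> r j" if "j \<in> ?P" for j
    using arg_min_least[OF P that, of r] by (simp add: jl_def)
  define \<theta> where "\<theta> = r jl"
  have th: "\<theta> \<ge> 0" using x0[of jl] jl by (simp add: \<theta>_def r_def divide_nonneg_neg)
  have xj: "?x j + \<theta> * v j \<ge> 0" if "j \<in> insert jt B" for j
  proof (cases "v j < 0")
    case True
    then have "j \<in> ?P" using that v by auto
    then show ?thesis using mn[of j] True by (simp add: \<theta>_def r_def field_simps)
  next
    case False
    have "?x jt = 0" using feasible_basis_solves[OF B] jt by (simp add: solves_def)
    then show ?thesis using x0[of j] False th that by (cases "j = jt") (auto simp: v)
  qed
  have s1: "solves n A \<beta> (insert jt B) ?x"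
    using feasible_basis_solves[OF B] fB by (auto intro: solves_supset)
  have "solves n A (\<lambda>i. \<beta> i + \<theta> * 0) (insert jt B) (\<lambda>j. ?x j + \<theta> * v j)"
    by (rule solves_add_scaled[OF s1 v(1)])
  then have s2: "solves n A \<beta> (insert jt B) (\<lambda>j. ?x j + \<theta> * v j)" by simp
  have s3: "solves n A \<beta> (insert jt (B - {jl})) (\<lambda>j. ?x j + \<theta> * v j)"
  proof (rule solves_subset[OF s2])
    fix j assume "j \<in> insert jt B - insert jt (B - {jl})"
    then have "j = jl" by auto
    then show "?x j + \<theta> * v j = 0" using jl by (simp add: \<theta>_def r_def)
  qed (use fB in auto)
  have "feasible_basis n N A \<beta> (insert jt (B - {jl}))"
  proof (rule feasible_basisI[OF _ _ _ s3])
    show "lin_indep_cols n A (insert jt (B - {jl}))"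
      using exchange_lin_indep_iff[OF li fB jt(2) jl(1) v] jl by auto
    show "card (insert jt (B - {jl})) = n"
      using fB cB jl jt card_Suc_Diff1[of B jl] by simp
    show "insert jt (B - {jl}) \<subseteq> {1..N}" using sB jt by auto
    show "?x j + \<theta> * v j \<ge> 0" if "j \<in> insert jt (B - {jl})" for j
      using that by (intro xj) auto
  qed
  then show ?thesis using jl by (auto simp: candidate_def)
qed

text \<open>All bases reachable by letting \<open>jt\<close> enter have their solutions on one line,
  and the value at \<open>jt\<close> is the step length. Later arguments about ties compare these
  lengths for two leaving columns.\<close>

lemma candidate_solution_on_line:
  assumes "feasible_basis n N A \<beta> B" "candidate n N A \<gamma> B jt jl" "jt \<notin> B"
    and v: "solves n A (\<lambda>_. 0) (insert jt B) v" "v jt = 1"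
  shows "basic_sol n A \<gamma> (insert jt (B - {jl})) j =
    basic_sol n A \<gamma> B j + basic_sol n A \<gamma> (insert jt (B - {jl})) jt * v j"
    and "basic_sol n A \<gamma> (insert jt (B - {jl})) jl = 0"
    and "v jl \<noteq> 0"
    and "basic_sol n A \<gamma> (insert jt (B - {jl})) jt \<ge> 0"
proof -
  have fB: "finite B" using assms finite_subset[of B "{1..N}"] by (simp add: feasible_basis_def)
  have li: "lin_indep_cols n A B" and c: "card B = n" using assms by (auto simp: feasible_basis_def)
  have fb: "feasible_basis n N A \<gamma> (insert jt (B - {jl}))" and jl: "jl \<in> B"
    using assms by (auto simp: candidate_def)
  have s: "solves n A \<gamma> (insert jt (B - {jl})) (basic_sol n A \<gamma> (insert jt (B - {jl})))"
    by (rule feasible_basis_solves[OF fb])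
  then have s': "solves n A \<gamma> (insert jt B) (basic_sol n A \<gamma> (insert jt (B - {jl})))"
    using fB by (elim solves_supset) auto
  show "basic_sol n A \<gamma> (insert jt (B - {jl})) j =
    basic_sol n A \<gamma> B j + basic_sol n A \<gamma> (insert jt (B - {jl})) jt * v j"
    by (rule solves_on_line[OF li fB assms(3) v basic_sol_solves[OF li fB c] s'])
  show "basic_sol n A \<gamma> (insert jt (B - {jl})) jl = 0"
    using s jl assms(3) by (auto simp: solves_def)
  show "v jl \<noteq> 0"
    using exchange_lin_indep_iff[OF li fB assms(3) jl v] fb by (simp add: feasible_basis_def)
  show "basic_sol n A \<gamma> (insert jt (B - {jl})) jt \<ge> 0"
    using fb by (simp add: feasible_basis_def)
qed

lemma nondegenerate_candidate_direction:
  assumes nd: "nondegenerate n N A \<beta>" and B: "feasible_basis n N A \<beta> B"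
    and cand: "candidate n N A \<beta> B jt jl" and jt: "jt \<notin> B"
    and v: "solves n A (\<lambda>_. 0) (insert jt B) v" "v jt = 1"
  shows "v jl < 0"
proof -
  let ?x' = "basic_sol n A \<beta> (insert jt (B - {jl}))"
  note line = candidate_solution_on_line[OF B cand jt v]
  have "basic_sol n A \<beta> B jl > 0" using nd B cand by (auto simp: nondegenerate_def candidate_def)
  moreover have "?x' jl = basic_sol n A \<beta> B jl + ?x' jt * v jl" by (rule line(1))
  ultimately have "?x' jt * v jl < 0" using line(2) by linarith
  then show ?thesis using line(4) by (simp add: mult_less_0_iff)
qed

text \<open>A candidate is still positive in the basis where the other one left, so the other one
  needs the strictly shorter step. This holds with the two exchanged as well.\<close>

lemma nondegenerate_candidate_unique:
  assumes nd: "nondegenerate n N A \<beta>" and B: "feasible_basis n N A \<beta> B"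
    and c1: "candidate n N A \<beta> B jt j1" and c2: "candidate n N A \<beta> B jt j2" and jt: "jt \<notin> B"
  shows "j1 = j2"
proof (rule ccontr)
  assume ne: "j1 \<noteq> j2"
  have fB: "finite B" using assms finite_subset[of B "{1..N}"] by (simp add: feasible_basis_def)
  obtain v where v: "solves n A (\<lambda>_. 0) (insert jt B) v" "v jt = 1"
    using pivot_direction_exists[of n A B jt] B fB jt by (auto simp: feasible_basis_def)
  have *: "basic_sol n A \<beta> (insert jt (B - {i2})) jt < basic_sol n A \<beta> (insert jt (B - {i1})) jt"
    if c: "candidate n N A \<beta> B jt i1" "candidate n N A \<beta> B jt i2" "i1 \<noteq> i2" for i1 i2
  proof -
    note l1 = candidate_solution_on_line[OF B c(1) jt v]
    note l2 = candidate_solution_on_line[OF B c(2) jt v]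
    have "i1 \<in> insert jt (B - {i2})" using c by (auto simp: candidate_def)
    then have "basic_sol n A \<beta> (insert jt (B - {i2})) i1 > 0"
      using nd c(2) by (auto simp: nondegenerate_def candidate_def)
    then have "basic_sol n A \<beta> (insert jt (B - {i1})) jt * v i1
        < basic_sol n A \<beta> (insert jt (B - {i2})) jt * v i1"
      using l1(1)[of i1] l1(2) l2(1)[of i1] by linarith
    then show ?thesis
      using nondegenerate_candidate_direction[OF nd B c(1) jt v] by (simp add: mult_less_cancel_right)
  qed
  show False using *[OF c1 c2 ne] *[OF c2 c1] ne by simp
qed

section \<open>Ordinal pivots\<close>

text \<open>The disliked column as a function of the agent, so that it can be stated to be a
  bijection.\<close>

definition worst :: "(nat \<Rightarrow> nat \<Rightarrow> nat) \<Rightarrow> nat set \<Rightarrow> nat \<Rightarrow> nat" where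
  "worst C D i = arg_min_on (C i) D"

lemma worst_props:
  assumes "finite D" "D \<noteq> {}"
  shows worst_in: "worst C D i \<in> D"
    and C_worst: "C i (worst C D i) = utility C D i"
    and utility_le: "j \<in> D \<Longrightarrow> utility C D i \<le> C i j"
proof -
  show w: "worst C D i \<in> D" unfolding worst_def by (rule arg_min_if_finite(1)[OF assms])
  show "j \<in> D \<Longrightarrow> utility C D i \<le> C i j" using assms by (simp add: utility_def)
  show "C i (worst C D i) = utility C D i"
    unfolding utility_def
    by (rule Min_eqI[symmetric])
      (use assms w in \<open>auto simp: worst_def intro!: arg_min_least\<close>)
qed

lemma utility_eqI:
  assumes "finite D" "j \<in> D" "\<And>h. h \<in> D \<Longrightarrow> C i j \<le> C i h"
  shows "utility C D i = C i j"
  unfolding utility_def by (rule Min_eqI) (use assms in auto)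

locale ordinal_matrix =
  fixes n N :: nat and C :: "nat \<Rightarrow> nat \<Rightarrow> nat"
  assumes inj_row: "i \<in> {1..n} \<Longrightarrow> inj_on (C i) {1..N}"
    and n_ge_2: "n \<ge> 2"
begin

lemma C_eq_imp_eq:
  "i \<in> {1..n} \<Longrightarrow> j \<in> {1..N} \<Longrightarrow> h \<in> {1..N} \<Longrightarrow> C i j = C i h \<Longrightarrow> j = h"
  by (rule inj_onD[OF inj_row])

lemma worst_eqI:
  assumes "i \<in> {1..n}" "D \<subseteq> {1..N}" "j \<in> D" "utility C D i = C i j"
  shows "worst C D i = j"
proof -
  have "finite D" "D \<noteq> {}" using assms finite_subset by auto
  from worst_in[OF this, of C i] C_worst[OF this, of C i]
  have "worst C D i \<in> {1..N}" "j \<in> {1..N}" "C i (worst C D i) = C i j"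
    using assms by auto
  then show ?thesis using C_eq_imp_eq[OF assms(1)] by metis
qed

lemma disliked_iff:
  assumes "i \<in> {1..n}" "D \<subseteq> {1..N}" "D \<noteq> {}"
  shows "disliked C D i j \<longleftrightarrow> j = worst C D i"
proof
  assume "disliked C D i j"
  then show "j = worst C D i" using worst_eqI[OF assms(1,2), of j] by (simp add: disliked_def)
next
  have "finite D" using assms(2) by (rule finite_subset) simp
  moreover assume "j = worst C D i"
  ultimately show "disliked C D i j"
    using worst_in[of D C i] C_worst[of D C i] assms(3) by (simp add: disliked_def)
qed

lemma ordinal_basisD:
  assumes "ordinal_basis n N C D"
  shows "D \<subseteq> {1..N}" "finite D" "D \<noteq> {}" "card D = n"
    "h \<in> {1..N} \<Longrightarrow> \<exists>i\<in>{1..n}. C i h \<le> utility C D i"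
proof -
  show D: "D \<subseteq> {1..N}" "card D = n" using assms by (simp_all add: ordinal_basis_def)
  show "finite D" using D(1) by (rule finite_subset) simp
  show "D \<noteq> {}" using D(2) n_ge_2 by auto
  show "\<exists>i\<in>{1..n}. C i h \<le> utility C D i" if "h \<in> {1..N}"
    using assms that unfolding ordinal_basis_def by blast
qed

text \<open>Each column of \<open>D\<close> is itself blocked by some row, and there it can only be
  the minimum. So the map is onto a set of the same size \<open>n\<close>.\<close>

lemma worst_bij:
  assumes "ordinal_basis n N C D"
  shows "bij_betw (worst C D) {1..n} D"
proof -
  note D = ordinal_basisD[OF assms]
  have "j \<in> worst C D ` {1..n}" if "j \<in> D" for j
  proof -
    obtain i where i: "i \<in> {1..n}" "C i j \<le> utility C D i" using D(1,5) \<open>j \<in> D\<close> by blast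
    then have "worst C D i = j"
      using worst_eqI[OF i(1) D(1) that] utility_le[OF D(2,3) that, of C i] by auto
    then show ?thesis using i by blast
  qed
  then have im: "worst C D ` {1..n} = D" using worst_in[OF D(2,3)] by blast
  then have "inj_on (worst C D) {1..n}" using D(4) by (intro eq_card_imp_inj_on) auto
  then show ?thesis using im by (simp add: bij_betw_def)
qed

lemma worst_inj:
  "ordinal_basis n N C D \<Longrightarrow> i \<in> {1..n} \<Longrightarrow> i' \<in> {1..n} \<Longrightarrow> worst C D i = worst C D i' \<Longrightarrow> i = i'"
  using bij_betw_imp_inj_on[OF worst_bij] inj_onD by metis

lemma worst_surj:
  "ordinal_basis n N C D \<Longrightarrow> j \<in> D \<Longrightarrow> \<exists>i\<in>{1..n}. worst C D i = j"
  using worst_bij[of D] by (metis bij_betw_imp_surj_on imageE)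

lemma utility_less:
  assumes "ordinal_basis n N C D" "i \<in> {1..n}" "j \<in> D" "worst C D i \<noteq> j"
  shows "utility C D i < C i j"
  using utility_le[OF ordinal_basisD(2,3)[OF assms(1)] assms(3), of C i]
    worst_eqI[OF assms(2) ordinal_basisD(1)[OF assms(1)] assms(3)] assms(4) by linarith

lemma utility_Diff:
  assumes "ordinal_basis n N C D" "i \<in> {1..n}" "worst C D i \<noteq> jl"
  shows "utility C (D - {jl}) i = utility C D i"
proof -
  note D = ordinal_basisD[OF assms(1)]
  have "utility C (D - {jl}) i = C i (worst C D i)"
    by (rule utility_eqI) (use D worst_in[OF D(2,3), of C i] C_worst[OF D(2,3), of C i] utility_le[OF D(2,3)] assms in auto)
  then show ?thesis using worst_props(2)[OF D(2,3), of C i] by simp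
qed

text \<open>
  Removing \<open>jl\<close> leaves one column, \<open>jr\<close>, that is worst for two rows, \<open>il\<close> and \<open>ir\<close>. The entering
  column is the best one for \<open>ir\<close> among those that no other row blocks.
\<close>

lemma ordinal_pivot:
  assumes D: "ordinal_basis n N C D"
    and il: "il \<in> {1..n}" and jl: "worst C D il = jl"
    and ir: "ir \<in> {1..n}" and jr: "worst C D ir = worst C (D - {jl}) il"
    and ex: "jx \<in> {1..N}" "\<And>i. i \<in> {1..n} - {ir} \<Longrightarrow> utility C (D - {jl}) i < C i jx"
  obtains js where "{j \<in> {1..N} - D. ordinal_basis n N C (insert j (D - {jl}))} = {js}"
    "worst C (insert js (D - {jl})) ir = js"
    "utility C (insert js (D - {jl})) ir < utility C D ir"
    "utility C D il < utility C (insert js (D - {jl})) il"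
    "\<forall>i\<in>{1..n} - {il, ir}. utility C (insert js (D - {jl})) i = utility C D i"
proof -
  note Dp = ordinal_basisD[OF D]
  let ?D0 = "D - {jl}"
  let ?u0 = "utility C ?D0"
  have jlD: "jl \<in> D" using worst_in[OF Dp(2,3), of C il] jl by simp
  have D0: "finite ?D0" "?D0 \<noteq> {}" "?D0 \<subseteq> {1..N}"
  proof -
    have "card ?D0 = n - 1" using Dp jlD by simp
    then show "?D0 \<noteq> {}" using n_ge_2 by (metis card.empty diff_is_0_eq not_less_eq_eq one_add_one plus_1_eq_Suc)
  qed (use Dp in auto)
  define jr where "jr = worst C ?D0 il"
  have jrD: "jr \<in> ?D0" using worst_in[OF D0(1,2)] by (simp add: jr_def)
  have jr1: "worst C D ir = jr" using jr by (simp add: jr_def)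
  have irl: "ir \<noteq> il" using jr1 jl jrD by auto
  have u0: "?u0 i = utility C D i" if "i \<in> {1..n}" "i \<noteq> il" for i
    using utility_Diff[OF D that(1), of jl] worst_inj[OF D that(1) il] that(2) jl by auto
  have u0il: "?u0 il = C il jr" using C_worst[OF D0(1,2), of C il] by (simp add: jr_def)
  have il_up: "utility C D il < ?u0 il"
    using utility_less[OF D il, of jr] jrD jl by (auto simp: u0il)
  have u0ir: "?u0 ir = C ir jr" using u0[OF ir irl] C_worst[OF Dp(2,3), of C ir] jr1 by simp
  \<comment> \<open>The columns that only row \<open>ir\<close> may block once \<open>jl\<close> is
    gone; \<open>jx\<close> ensures that there is one.\<close>
  define M where "M = {j \<in> {1..N}. \<forall>i\<in>{1..n} - {ir}. ?u0 i < C i j}"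
  have MD: "M \<inter> D = {}"
  proof -
    have False if j: "j \<in> M" "j \<in> D" for j
    proof -
      obtain i where i: "i \<in> {1..n}" "worst C D i = j" using worst_surj[OF D j(2)] by blast
      have Ci: "C i j = utility C D i" using C_worst[OF Dp(2,3), of C i] i by simp
      consider "i = il" | "i = ir" | "i \<noteq> il" "i \<noteq> ir" by blast
      then show False
      proof cases
        case 1
        then have "?u0 il < C il j" using j irl il by (auto simp: M_def)
        then show False using il_up Ci 1 by simp
      next
        case 2
        then have "?u0 il < C il jr" using j irl il i jr1 by (auto simp: M_def)
        then show False by (simp add: u0il)
      next
        case 3
        then have "?u0 i < C i j" using j i by (auto simp: M_def)
        then show False using u0[OF i(1) 3(1)] Ci by simp
      qed
    qed
    then show ?thesis by blast
  qed
  \<comment> \<open>The old basis \<open>D\<close> must block \<open>j\<close> in some row. Every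
    other row is excluded by \<open>M\<close>, since removing \<open>jl\<close> lowers no utility,
    so the blocking row is \<open>ir\<close>.\<close>
  have M_below: "C ir j < ?u0 ir" if j: "j \<in> M" for j
  proof -
    have jN: "j \<in> {1..N}" using j by (simp add: M_def)
    obtain i where i: "i \<in> {1..n}" "C i j \<le> utility C D i" using Dp(5)[OF jN] by blast
    have "i = ir"
    proof (rule ccontr)
      assume ne: "i \<noteq> ir"
      then have "?u0 i < C i j" using i j by (auto simp: M_def)
      then show False using i u0[of i] il_up by (cases "i = il") auto
    qed
    then have "C ir j \<le> ?u0 ir" using i u0[OF ir irl] by simp
    moreover have "C ir j \<noteq> ?u0 ir"
      using C_eq_imp_eq[OF ir jN, of jr] u0ir jrD D0(3) MD j by (metis DiffD1 disjoint_iff subsetD)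
    ultimately show ?thesis by simp
  qed
  have MN: "M \<subseteq> {1..N}" by (auto simp: M_def)
  have Mf: "finite M" using MN finite_subset by blast
  have "jx \<in> M" using ex by (simp add: M_def)
  then have "finite (C ir ` M)" "C ir ` M \<noteq> {}" using Mf by auto
  then have "Max (C ir ` M) \<in> C ir ` M" by (rule Max_in)
  then obtain js where js: "js \<in> M" "C ir js = Max (C ir ` M)" by auto
  have js_max: "C ir j \<le> C ir js" if "j \<in> M" for j using js Mf that by simp
  let ?D' = "insert js ?D0"
  have D'f: "finite ?D'" using D0 by simp
  have u'ir: "utility C ?D' ir = C ir js"
  proof (rule utility_eqI[OF D'f])
    fix h assume "h \<in> ?D'"
    then show "C ir js \<le> C ir h"
      using M_below[OF js(1)] utility_le[OF D0(1,2), of h C ir] by auto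
  qed simp
  have u': "utility C ?D' i = ?u0 i" if "i \<in> {1..n} - {ir}" for i
  proof -
    have "?u0 i < C i js" using js that by (auto simp: M_def)
    then have "utility C ?D' i = C i (worst C ?D0 i)"
      using worst_in[OF D0(1,2), of C i] C_worst[OF D0(1,2), of C i] utility_le[OF D0(1,2)] by (intro utility_eqI[OF D'f]) auto
    then show ?thesis using C_worst[OF D0(1,2)] by simp
  qed
  have js_notin: "js \<notin> D" using MD js by blast
  have D'N: "?D' \<subseteq> {1..N}" using D0 MN js by auto
  have D'c: "card ?D' = n" using js_notin Dp jlD n_ge_2 by (simp add: card_Diff_singleton)
  have D': "ordinal_basis n N C ?D'"
    unfolding ordinal_basis_def
  proof (intro conjI ballI)
    fix h assume h: "h \<in> {1..N}"
    show "\<exists>i\<in>{1..n}. C i h \<le> utility C ?D' i"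
    proof (cases "h \<in> M")
      case True
      then have "C ir h \<le> utility C ?D' ir" using js_max u'ir by simp
      then show ?thesis using ir by blast
    next
      case False
      then obtain i where i: "i \<in> {1..n} - {ir}" "\<not> ?u0 i < C i h" using h unfolding M_def by blast
      then show ?thesis using u'[OF i(1)] by (intro bexI[of _ i]) auto
    qed
  qed (use D'N D'c in auto)
  have uniq: "j = js" if j: "j \<in> {1..N} - D" "ordinal_basis n N C (insert j ?D0)" for j
  proof -
    let ?D2 = "insert j ?D0"
    note D2 = ordinal_basisD[OF j(2)]
    obtain i0 where i0: "i0 \<in> {1..n}" "worst C ?D2 i0 = j"
      using worst_surj[OF j(2), of j] by blast
    have less: "utility C ?D2 i < C i j" if "i \<in> {1..n}" "i \<noteq> i0" for i
      using utility_less[OF j(2) that(1), of j] worst_inj[OF j(2) that(1) i0(1)] that(2) i0(2) by auto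
    have u2: "utility C ?D2 i = ?u0 i" if "i \<in> {1..n}" "i \<noteq> i0" for i
    proof -
      have "j \<notin> ?D0" using j by simp
      then have "insert j ?D0 - {j} = ?D0" by simp
      then show ?thesis
        using utility_Diff[OF j(2) that(1), of j] worst_inj[OF j(2) that(1) i0(1)] that(2) i0(2)
        by metis
    qed
    have w2: "worst C ?D2 i = worst C ?D0 i" if "i \<in> {1..n}" "i \<noteq> i0" for i
      by (rule worst_eqI[OF that(1) D2(1)])
        (use worst_in[OF D0(1,2), of C i] C_worst[OF D0(1,2), of C i] utility_le[OF D0(1,2)] u2[OF that] in auto)
    have w0: "worst C ?D0 i = worst C D i" if "i \<in> {1..n}" "i \<noteq> il" for i
    proof (rule worst_eqI[OF that(1) D0(3)])
      show "worst C D i \<in> ?D0" using worst_in[OF Dp(2,3), of C i] worst_inj[OF D that(1) il] that jl by auto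
      show "utility C ?D0 i = C i (worst C D i)" using u0[OF that] C_worst[OF Dp(2,3), of C i] by simp
    qed
    \<comment> \<open>If the new column were worst for a third row, \<open>il\<close> and
      \<open>ir\<close> would still share \<open>jr\<close> as their worst column.\<close>
    have "i0 = il \<or> i0 = ir"
    proof (rule ccontr)
      assume "\<not> ?thesis"
      then have "worst C ?D2 il = worst C ?D2 ir"
        using w2[OF il] w2[OF ir] w0[OF ir irl] jr1 by (simp add: jr_def)
      then show False using worst_inj[OF j(2) il ir] irl by simp
    qed
    then show "j = js"
    proof
      \<comment> \<open>This alternative only undoes the removal: \<open>jl\<close> and
        \<open>j\<close> block each other in row \<open>il\<close>, so \<open>j\<close> would be
        \<open>jl\<close>.\<close>
      assume e: "i0 = il"
      have jlN: "jl \<in> {1..N}" using jlD Dp by auto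
      obtain i1 where i1: "i1 \<in> {1..n}" "C i1 jl \<le> utility C ?D2 i1" using D2(5)[OF jlN] by blast
      have "i1 = il"
      proof (rule ccontr)
        assume ne: "i1 \<noteq> il"
        have "utility C D i1 < C i1 jl"
          using utility_less[OF D i1(1) jlD] worst_inj[OF D i1(1) il] ne jl by auto
        then show False using i1 u2[OF i1(1)] u0[OF i1(1) ne] ne e by simp
      qed
      then have a: "C il jl \<le> C il j" using i1 C_worst[OF D2(2,3), of C i0] i0 e by simp
      obtain i3 where i3: "i3 \<in> {1..n}" "C i3 j \<le> utility C D i3" using Dp(5)[of j] j by blast
      have "i3 = il"
      proof (rule ccontr)
        assume ne: "i3 \<noteq> il"
        then have "utility C D i3 < C i3 j"
          using less[OF i3(1)] u2[OF i3(1)] u0[OF i3(1) ne] e by simp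
        then show False using i3 by simp
      qed
      then have "C il j \<le> C il jl" using i3 C_worst[OF Dp(2,3), of C il] jl by simp
      then have "j = jl" using C_eq_imp_eq[OF il _ jlN, of j] a j by auto
      then show ?thesis using j jlD by simp
    next
      \<comment> \<open>Now \<open>j\<close> lies in \<open>M\<close>, and only row
        \<open>ir\<close> can block \<open>js\<close>, so \<open>j\<close> attains the maximum over
        \<open>M\<close> as well.\<close>
      assume e: "i0 = ir"
      have "?u0 i < C i j" if "i \<in> {1..n} - {ir}" for i using less[of i] u2[of i] e that by simp
      then have jM: "j \<in> M" using j unfolding M_def by blast
      have jsN: "js \<in> {1..N}" using js MN by auto
      obtain i1 where i1: "i1 \<in> {1..n}" "C i1 js \<le> utility C ?D2 i1" using D2(5)[OF jsN] by blast
      have "i1 = ir"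
      proof (rule ccontr)
        assume ne: "i1 \<noteq> ir"
        then have "?u0 i1 < C i1 js" using js i1 by (auto simp: M_def)
        then show False using i1 u2[OF i1(1)] ne e by simp
      qed
      then have "C ir js \<le> C ir j" using i1 C_worst[OF D2(2,3), of C i0] i0 e by simp
      then have "C ir js = C ir j" using js_max[OF jM] by simp
      then show ?thesis using C_eq_imp_eq[OF ir jsN, of j] j by auto
    qed
  qed
  have jsN: "js \<in> {1..N}" using js MN by auto
  have 1: "{j \<in> {1..N} - D. ordinal_basis n N C (insert j (D - {jl}))} = {js}"
  proof (rule set_eqI)
    fix j
    show "j \<in> {j \<in> {1..N} - D. ordinal_basis n N C (insert j (D - {jl}))} \<longleftrightarrow> j \<in> {js}"
      using uniq[of j] D' js_notin jsN by (cases "j = js") auto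
  qed
  have 2: "worst C ?D' ir = js" by (rule worst_eqI[OF ir D'N]) (simp_all add: u'ir)
  have 3: "utility C ?D' ir < utility C D ir" using u'ir M_below[OF js(1)] u0[OF ir irl] by simp
  have 4: "utility C D il < utility C ?D' il" using u'[of il] il irl il_up by simp
  have 5: "utility C ?D' i = utility C D i" if "i \<in> {1..n} - {il, ir}" for i
    using u'[of i] u0[of i] that by simp
  show thesis by (rule that[OF 1 2 3 4]) (use 5 in blast)
qed

end

section \<open>The columns of the marriage matrices\<close>

text \<open>Counted from 0; \<open>edge_rank\<close> is its successor on
  \<open>edge_prefs\<close>.\<close>

definition position :: "'a list \<Rightarrow> 'a \<Rightarrow> nat" where
  "position xs x = length (takeWhile (\<lambda>y. y \<noteq> x) xs)"

lemma position_less: "x \<in> set xs \<Longrightarrow> position xs x < length xs"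
  unfolding position_def by (induction xs) auto

lemma nth_position: "x \<in> set xs \<Longrightarrow> xs ! position xs x = x"
  unfolding position_def by (induction xs) auto

lemma position_inj:
  assumes "x \<in> set xs" "y \<in> set xs" "position xs x = position xs y"
  shows "x = y"
proof -
  have "x = xs ! position xs x" using nth_position[OF assms(1)] ..
  also have "\<dots> = xs ! position xs y" unfolding assms(3) ..
  also have "\<dots> = y" by (rule nth_position[OF assms(2)])
  finally show ?thesis .
qed

lemma position_nth:
  assumes "distinct xs" "i < length xs"
  shows "position xs (xs ! i) = i"
proof -
  have m: "xs ! i \<in> set xs" using assms by simp
  show ?thesis
    using nth_eq_iff_index_eq[OF assms(1) position_less[OF m] assms(2)] nth_position[OF m] by blast
qed

lemma sorted_wrt_position:
  assumes "distinct xs"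
  shows "sorted_wrt (\<lambda>x y. position xs x < position xs y) xs"
  unfolding sorted_wrt_iff_nth_less
proof (intro allI impI)
  fix i j assume "i < j" "j < length xs"
  then show "position xs (xs ! i) < position xs (xs ! j)"
    using position_nth[OF assms, of i] position_nth[OF assms, of j] by simp
qed

lemma position_append1: "x \<in> set xs \<Longrightarrow> position (xs @ ys) x = position xs x"
  unfolding position_def by (subst takeWhile_append1[of x]) auto

lemma position_append2: "x \<notin> set xs \<Longrightarrow> position (xs @ ys) x = length xs + position ys x"
  unfolding position_def by (subst takeWhile_append2) auto

lemma position_map: "inj f \<Longrightarrow> position (map f xs) (f x) = position xs x"
  unfolding position_def by (simp add: takeWhile_map comp_def inj_eq)

locale marriage =
  fixes k :: nat and mp wp :: "nat \<Rightarrow> nat list"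
  assumes k_pos: "k \<ge> 1" and inst: "complete_marriage_instance k mp wp"
begin

definition n :: nat where "n = 2 * k"
definition N :: nat where "N = n + k^2"

abbreviation edge :: "nat \<Rightarrow> edge" where "edge \<equiv> col_edge k mp"
abbreviation A :: "nat \<Rightarrow> nat \<Rightarrow> real" where "A \<equiv> matrix_A k mp"
abbreviation C :: "nat \<Rightarrow> nat \<Rightarrow> nat" where "C \<equiv> matrix_C k mp wp"

text \<open>The left-to-right order of the columns expressed on their edges, so that column indices
  are compared without computing them.\<close>

fun before :: "edge \<Rightarrow> edge \<Rightarrow> bool" where
  "before (Loop i) (Loop j) \<longleftrightarrow> i < j"
| "before (Loop i) (Valid a b) \<longleftrightarrow> True"
| "before (Valid a b) (Loop i) \<longleftrightarrow> False"
| "before (Valid a b) (Valid a' b') \<longleftrightarrow>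
     a < a' \<or> a = a' \<and> position (mp a) b < position (mp a) b'"

section \<open>Columns as edges\<close>

lemma mp: "a \<in> {1..k} \<Longrightarrow> distinct (mp a)" "a \<in> {1..k} \<Longrightarrow> set (mp a) = {1..k}"
  and wp: "a \<in> {1..k} \<Longrightarrow> distinct (wp a)" "a \<in> {1..k} \<Longrightarrow> set (wp a) = {1..k}"
  using inst by (auto simp: complete_marriage_instance_def)

lemma length_mp: "a \<in> {1..k} \<Longrightarrow> length (mp a) = k"
  using distinct_card[OF mp(1), of a] mp(2)[of a] by simp

lemma length_wp: "a \<in> {1..k} \<Longrightarrow> length (wp a) = k"
  using distinct_card[OF wp(1), of a] wp(2)[of a] by simp

lemma woman_index: "v \<in> {1..n} \<Longrightarrow> \<not> v \<le> k \<Longrightarrow> v - k \<in> {1..k}"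
  by (auto simp: n_def)

lemma length_column_edges: "length (column_edges k mp) = N"
proof -
  have "(\<Sum>i\<leftarrow>[1..<k+1]. length (mp i)) = (\<Sum>i\<leftarrow>[1..<k+1]. k)"
    by (rule arg_cong[of _ _ sum_list], rule map_cong) (auto simp: length_mp)
  then show ?thesis
    by (simp add: column_edges_def length_concat comp_def N_def n_def sum_list_triv power2_eq_square)
qed

lemma sorted_valid_blocks:
  assumes "set is \<subseteq> {1..k}" "sorted_wrt (<) is"
  shows "sorted_wrt before (concat (map (\<lambda>i. map (Valid i) (mp i)) is))"
  using assms
proof (induction "is")
  case (Cons a "is")
  have "sorted_wrt before (map (Valid a) (mp a))"
    using sorted_wrt_position[of "mp a"] mp Cons.prems by (simp add: sorted_wrt_map)
  then show ?case using Cons by (auto simp: sorted_wrt_append)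
qed simp

lemma sorted_column_edges: "sorted_wrt before (column_edges k mp)"
proof -
  have "sorted_wrt before (map Loop [1..<2*k+1])"
    unfolding sorted_wrt_map before.simps by (rule sorted_wrt_upt)
  moreover have "sorted_wrt before (concat (map (\<lambda>i. map (Valid i) (mp i)) [1..<k+1]))"
    by (rule sorted_valid_blocks) (auto simp del: upt_Suc)
  ultimately show ?thesis unfolding column_edges_def by (auto simp: sorted_wrt_append)
qed

lemma edge_before:
  assumes "j \<in> {1..N}" "j' \<in> {1..N}" "j < j'"
  shows "before (edge j) (edge j')"
  unfolding col_edge_def
  by (rule sorted_wrt_nth_less[OF sorted_column_edges])
    (use assms in \<open>auto simp: length_column_edges\<close>)

lemma before_irrefl: "\<not> before e e"
  by (cases e) auto

lemma edge_inj: "inj_on edge {1..N}"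
proof (rule inj_onI)
  fix j j' assume j: "j \<in> {1..N}" "j' \<in> {1..N}" "edge j = edge j'"
  then have "\<not> before (edge j) (edge j')" "\<not> before (edge j') (edge j)"
    using before_irrefl by simp_all
  then show "j = j'" using edge_before j by (meson linorder_neqE_nat)
qed

lemma edge_less_iff:
  assumes "j \<in> {1..N}" "j' \<in> {1..N}"
  shows "before (edge j) (edge j') \<longleftrightarrow> j < j'"
proof
  assume b: "before (edge j) (edge j')"
  have "\<not> j' < j"
  proof
    assume "j' < j"
    then have "before (edge j') (edge j)" using edge_before assms by blast
    then show False using b by (cases "edge j"; cases "edge j'") auto
  qed
  moreover have "j \<noteq> j'" using b before_irrefl by auto
  ultimately show "j < j'" by simp
qed (use assms edge_before in blast)

lemma edge_loop: "j \<in> {1..n} \<Longrightarrow> edge j = Loop j"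
  by (auto simp: col_edge_def column_edges_def nth_append n_def)

lemma edge_image: "edge ` {1..N} = Loop ` {1..n} \<union> {Valid a b | a b. a \<in> {1..k} \<and> b \<in> {1..k}}"
proof -
  have "edge ` {1..N} = set (column_edges k mp)"
  proof -
    have "edge ` {1..N} = edge ` Suc ` {0..<N}" by (simp add: image_Suc_atLeastLessThan atLeastLessThanSuc_atLeastAtMost)
    also have "\<dots> = (!) (column_edges k mp) ` {0..<N}" unfolding image_image by (simp add: col_edge_def)
    also have "\<dots> = set (column_edges k mp)"
      using nth_image[of N "column_edges k mp"] length_column_edges by (simp add: lessThan_atLeast0)
    finally show ?thesis .
  qed
  also have "\<dots> = Loop ` {1..<2*k+1} \<union> (\<Union>i\<in>{1..<k+1}. Valid i ` set (mp i))"
    by (simp add: column_edges_def del: upt_Suc)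
  also have "(\<Union>i\<in>{1..<k+1}. Valid i ` set (mp i)) = (\<Union>i\<in>{1..k}. Valid i ` {1..k})"
    using mp(2) by (intro SUP_cong) auto
  also have "{1..<2*k+1} = {1..n}" by (auto simp: n_def)
  finally show ?thesis by auto
qed

definition valid_column :: "nat \<Rightarrow> bool" where
  "valid_column j \<longleftrightarrow> j \<in> {n<..N}"

lemma n_le_N: "n \<le> N" by (simp add: N_def)
lemma n_ge2: "n \<ge> 2" using k_pos by (simp add: n_def)

lemma valid_col:
  assumes "valid_column j"
  obtains a b where "edge j = Valid a b" "a \<in> {1..k}" "b \<in> {1..k}"
proof -
  have j: "j \<in> {1..N}" using assms by (auto simp: valid_column_def)
  have "edge j \<noteq> Loop i" if "i \<in> {1..n}" for i
    using edge_inj edge_loop[OF that] j assms that n_le_N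
    by (metis atLeastAtMost_iff greaterThanAtMost_iff inj_onD valid_column_def leD order_trans)
  moreover have "edge j \<in> edge ` {1..N}" using j by blast
  ultimately have "edge j \<in> {Valid a b | a b. a \<in> {1..k} \<and> b \<in> {1..k}}"
    unfolding edge_image by blast
  then show thesis using that by blast
qed

lemma valid_col_exists:
  assumes "a \<in> {1..k}" "b \<in> {1..k}"
  obtains j where "valid_column j" "edge j = Valid a b"
proof -
  have "Valid a b \<in> edge ` {1..N}" unfolding edge_image using assms by blast
  then obtain j where j: "j \<in> {1..N}" "edge j = Valid a b" by auto
  moreover have "j \<notin> {1..n}" using j edge_loop by auto
  ultimately have "valid_column j" by (auto simp: valid_column_def)
  then show thesis using j that by blast
qed

lemma not_valid_column: "j \<in> {1..N} \<Longrightarrow> \<not> valid_column j \<longleftrightarrow> j \<in> {1..n}" by (auto simp: valid_column_def)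

lemma is_valid_edge: "j \<in> {1..N} \<Longrightarrow> is_valid (edge j) \<longleftrightarrow> valid_column j"
proof (cases "valid_column j")
  case True
  then show ?thesis using valid_col[of j] by fastforce
next
  case False
  assume "j \<in> {1..N}"
  then show ?thesis using False not_valid_column[of j] edge_loop[of j] by simp
qed

lemma valid_column_le: "valid_column j \<Longrightarrow> j \<in> {1..N}" by (auto simp: valid_column_def)

abbreviation inc :: "nat \<Rightarrow> nat \<Rightarrow> bool" where
  "inc v j \<equiv> v \<in> ends k (edge j)"

lemma inc_loop: "j \<in> {1..n} \<Longrightarrow> inc v j \<longleftrightarrow> v = j" by (simp add: edge_loop)

section \<open>The three kinds of entries in a row of \<open>C\<close>\<close>

lemma edge_prefs_mem:
  assumes "v \<in> {1..n}" "j \<in> {1..N}" "inc v j"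
  shows "edge j \<in> set (edge_prefs k mp wp v)"
proof (cases "valid_column j")
  case True
  then obtain a b where ab: "edge j = Valid a b" "a \<in> {1..k}" "b \<in> {1..k}" by (rule valid_col)
  then show ?thesis using assms mp wp by (auto simp: edge_prefs_def)
next
  case False
  then have "edge j = Loop v" using assms not_valid_column edge_loop by auto
  then show ?thesis by (simp add: edge_prefs_def)
qed

lemma length_edge_prefs: "v \<in> {1..n} \<Longrightarrow> length (edge_prefs k mp wp v) = k + 1"
  using length_mp[of v] length_wp[OF woman_index[of v]] by (auto simp: edge_prefs_def)

lemma C_inc:
  assumes "inc v j"
  shows "C v j = k - position (edge_prefs k mp wp v) (edge j)"
  using assms by (simp add: matrix_C_def Let_def edge_rank_def position_def)

lemma C_loop_self: assumes "v \<in> {1..n}" shows "C v v = 0"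
proof -
  have "position (edge_prefs k mp wp v) (Loop v) = k"
    using assms length_mp[of v] length_wp[OF woman_index[of v]] unfolding edge_prefs_def
    by (subst position_append2) (auto simp: position_def)
  then show ?thesis using C_inc[of v v] assms by (simp add: edge_loop)
qed

lemma C_inc_le: "inc v j \<Longrightarrow> C v j \<le> k"
  by (simp add: C_inc)

lemma C_inc_inj:
  assumes "v \<in> {1..n}" "j \<in> {1..N}" "j' \<in> {1..N}" "inc v j" "inc v j'" "C v j = C v j'"
  shows "j = j'"
proof -
  let ?p = "edge_prefs k mp wp v"
  have m: "edge j \<in> set ?p" "edge j' \<in> set ?p" using edge_prefs_mem assms by auto
  have "position ?p (edge j) \<le> k" "position ?p (edge j') \<le> k"
    using position_less[OF m(1)] position_less[OF m(2)] length_edge_prefs assms by auto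
  then have "position ?p (edge j) = position ?p (edge j')" using assms(6) by (simp add: C_inc assms(4,5))
  then have "edge j = edge j'" using position_inj m by metis
  then show ?thesis using edge_inj assms by (auto dest: inj_onD)
qed

lemma C_inc_valid_pos:
  assumes "v \<in> {1..n}" "valid_column j" "inc v j"
  shows "C v j \<noteq> 0"
proof
  assume "C v j = 0"
  then have "j = v"
    using C_inc_inj[of v j v] assms C_loop_self valid_column_le n_le_N by (auto simp: edge_loop)
  then show False using assms by (auto simp: valid_column_def)
qed

lemma C_man_less:
  assumes "a \<in> {1..k}" "valid_column j" "valid_column j'" "inc a j" "inc a j'" "j < j'"
  shows "C a j' < C a j"
proof -
  obtain x b where j: "edge j = Valid x b" "x \<in> {1..k}" "b \<in> {1..k}" using assms(2) by (rule valid_col)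
  obtain x' b' where j': "edge j' = Valid x' b'" "x' \<in> {1..k}" "b' \<in> {1..k}" using assms(3) by (rule valid_col)
  have x: "x = a" "x' = a" using j j' assms by auto
  have p: "position (edge_prefs k mp wp a) (Valid a b) = position (mp a) b" if "b \<in> {1..k}" for b
    using that assms mp(2)[OF assms(1)] unfolding edge_prefs_def
    by (subst position_append1) (auto simp: position_map inj_def)
  have "before (edge j) (edge j')" using edge_before valid_column_le assms by blast
  then have "position (mp a) b < position (mp a) b'" using j j' x by simp
  moreover have "position (mp a) b' < k"
    using position_less[of b' "mp a"] mp(2)[OF assms(1)] length_mp[OF assms(1)] j' by simp
  ultimately show ?thesis using C_inc[OF assms(4)] C_inc[OF assms(5)] p j j' x by simp
qed

lemma C_noninc_valid:
  assumes "valid_column j" "\<not> inc v j"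
  shows "C v j = k + card {j' \<in> {j..N}. valid_column j' \<and> \<not> inc v j'}"
proof -
  have "{j' \<in> {j..2*k + k^2}. is_valid (edge j') \<and> \<not> inc v j'} =
      {j' \<in> {j..N}. valid_column j' \<and> \<not> inc v j'}"
    using is_valid_edge assms by (auto simp: N_def n_def valid_column_def)
  then show ?thesis using assms is_valid_edge[OF valid_column_le[OF assms(1)]]
    by (simp add: matrix_C_def Let_def)
qed

lemma C_noninc_valid_less:
  assumes "valid_column j" "\<not> inc v j" "valid_column j'" "\<not> inc v j'" "j < j'"
  shows "C v j' < C v j"
proof -
  have "{h \<in> {j'..N}. valid_column h \<and> \<not> inc v h} \<subset> {h \<in> {j..N}. valid_column h \<and> \<not> inc v h}"
  proof (rule psubsetI)
    have "j \<in> {h \<in> {j..N}. valid_column h \<and> \<not> inc v h}" using assms valid_column_le[of j] by simp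
    moreover have "j \<notin> {h \<in> {j'..N}. valid_column h \<and> \<not> inc v h}" using assms by simp
    ultimately show "{h \<in> {j'..N}. valid_column h \<and> \<not> inc v h} \<noteq> {h \<in> {j..N}. valid_column h \<and> \<not> inc v h}"
      by blast
  qed (use assms in auto)
  then show ?thesis using assms by (simp add: C_noninc_valid psubset_card_mono)
qed

lemma C_noninc_gt: "valid_column j \<Longrightarrow> \<not> inc v j \<Longrightarrow> k < C v j"
  using valid_column_le[of j] by (auto simp: C_noninc_valid card_gt_0_iff)

text \<open>At least \<open>k\<close> of the \<open>k^2\<close> valid columns contain
  \<open>v\<close>, so the offset above \<open>k\<close> is at most \<open>k^2 - k\<close>.\<close>

lemma C_noninc_le:
  assumes "v \<in> {1..n}" "valid_column j" "\<not> inc v j"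
  shows "C v j \<le> k^2"
proof -
  let ?I = "{j. valid_column j \<and> inc v j}"
  have V: "{j. valid_column j} = {n<..N}" by (auto simp: valid_column_def)
  then have f: "finite {j. valid_column j}" by simp
  have sub: "\<exists>j. valid_column j \<and> edge j = e"
    if "e \<in> (if v \<le> k then Valid v ` {1..k} else (\<lambda>a. Valid a (v - k)) ` {1..k})" for e
    using that valid_col_exists[of v] valid_col_exists[OF _ woman_index[OF assms(1)]] assms(1)
    by (auto split: if_splits) (metis atLeastAtMost_iff One_nat_def)+
  have "k = card (if v \<le> k then Valid v ` {1..k} else (\<lambda>a. Valid a (v - k)) ` {1..k})"
    by (auto simp: card_image inj_on_def)
  also have "\<dots> \<le> card (edge ` ?I)"
  proof (rule card_mono)
    show "finite (edge ` ?I)" using f by simp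
    show "(if v \<le> k then Valid v ` {1..k} else (\<lambda>a. Valid a (v - k)) ` {1..k}) \<subseteq> edge ` ?I"
    proof
      fix e assume e: "e \<in> (if v \<le> k then Valid v ` {1..k} else (\<lambda>a. Valid a (v - k)) ` {1..k})"
      obtain j where j: "valid_column j" "edge j = e" using sub[OF e] by blast
      have "v \<in> ends k e" using e by (auto split: if_splits)
      then show "e \<in> edge ` ?I" using j by blast
    qed
  qed
  also have "\<dots> \<le> card ?I" using f by (intro card_image_le) auto
  finally have kI: "k \<le> card ?I" .
  have "card {j' \<in> {j..N}. valid_column j' \<and> \<not> inc v j'} \<le> card ({j. valid_column j} - ?I)"
    using f by (intro card_mono) auto
  also have "\<dots> = card {j. valid_column j} - card ?I"
    using finite_subset[OF _ f] by (intro card_Diff_subset) auto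
  also have "\<dots> = k^2 - card ?I" by (simp add: V N_def)
  finally have "card {j' \<in> {j..N}. valid_column j' \<and> \<not> inc v j'} \<le> k^2 - k" using kI by simp
  moreover have "k \<le> k^2" by (simp add: power2_eq_square)
  ultimately show ?thesis using assms by (simp add: C_noninc_valid)
qed

lemma k_le_square: "k \<le> k^2" by (simp add: power2_eq_square)

lemma C_valid_le: "v \<in> {1..n} \<Longrightarrow> valid_column j \<Longrightarrow> C v j \<le> k^2"
  using C_noninc_le[of v j] C_inc_le[of v j] k_le_square by linarith

lemma C_loop_other:
  assumes "j \<in> {1..n}" "v \<noteq> j"
  shows "C v j = k^2 + card {j' \<in> {j..n}. j' \<noteq> v}"
  using assms by (simp add: matrix_C_def Let_def edge_loop n_def)

lemma C_loop_gt: "j \<in> {1..n} \<Longrightarrow> v \<noteq> j \<Longrightarrow> k^2 < C v j"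
  by (simp add: C_loop_other card_gt_0_iff) (metis order_refl)

lemma C_loop_less:
  assumes "j \<in> {1..n}" "v \<noteq> j" "j' \<in> {1..n}" "v \<noteq> j'" "j < j'"
  shows "C v j' < C v j"
proof -
  have "{h \<in> {j'..n}. h \<noteq> v} \<subset> {h \<in> {j..n}. h \<noteq> v}"
  proof (rule psubsetI)
    have "j \<in> {h \<in> {j..n}. h \<noteq> v}" "j \<notin> {h \<in> {j'..n}. h \<noteq> v}" using assms by simp_all
    then show "{h \<in> {j'..n}. h \<noteq> v} \<noteq> {h \<in> {j..n}. h \<noteq> v}" by blast
  qed (use assms in auto)
  then have "card {h \<in> {j'..n}. h \<noteq> v} < card {h \<in> {j..n}. h \<noteq> v}"
    by (intro psubset_card_mono) simp
  then show ?thesis using C_loop_other[OF assms(1,2)] C_loop_other[OF assms(3,4)] by linarith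
qed

text \<open>The thresholds \<open>k\<close> and \<open>k^2\<close> separate incident edges, other
  valid edges and other loops. Through them the size of a utility tells which kind of column is
  disliked.\<close>

lemma C_le_k_iff:
  assumes "v \<in> {1..n}" "j \<in> {1..N}"
  shows "C v j \<le> k \<longleftrightarrow> inc v j"
proof (cases "valid_column j")
  case True
  then show ?thesis using C_inc_le[of v j] C_noninc_gt[of j v] by linarith
next
  case False
  then have "j \<in> {1..n}" using not_valid_column assms by blast
  then show ?thesis
    using C_inc_le[of v j] C_loop_gt[of j v] inc_loop[of j v] k_le_square by linarith
qed

lemma C_le_square_iff:
  assumes "v \<in> {1..n}" "j \<in> {1..N}"
  shows "C v j \<le> k^2 \<longleftrightarrow> valid_column j \<or> j = v"
proof (cases "valid_column j")
  case True
  then show ?thesis using C_valid_le[OF assms(1)] by simp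
next
  case False
  then have "j \<in> {1..n}" using not_valid_column[OF assms(2)] by blast
  then show ?thesis
    using False C_loop_gt[of j v] C_loop_self[OF assms(1)] by (cases "j = v") (simp_all add: not_le)
qed

text \<open>By the thresholds, equal entries belong to columns of the same kind, and within a kind
  the entries are distinct.\<close>

lemma C_inj_row: assumes "v \<in> {1..n}" shows "inj_on (C v) {1..N}"
proof -
  have "C v j \<noteq> C v j'" if j: "j \<in> {1..N}" "j' \<in> {1..N}" "j < j'" for j j'
  proof
    assume e: "C v j = C v j'"
    then have i: "inc v j \<longleftrightarrow> inc v j'" and s: "valid_column j \<or> j = v \<longleftrightarrow> valid_column j' \<or> j' = v"
      using C_le_k_iff[OF assms] C_le_square_iff[OF assms] j by metis+
    show False
    proof (cases "inc v j")
      case True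
      then show False using C_inc_inj[OF assms j(1,2)] i e j(3) by simp
    next
      case False
      then have ne: "j \<noteq> v" "j' \<noteq> v" using i inc_loop[of v v] assms by auto
      show False
      proof (cases "valid_column j")
        case True
        then show False using C_noninc_valid_less[of j v j'] False i s ne e j(3) by simp
      next
        case False
        then show False using C_loop_less[of j v j'] s ne e j not_valid_column by auto
      qed
    qed
  qed
  then show ?thesis by (metis (no_types, lifting) inj_onI linorder_neqE_nat)
qed

sublocale ordinal_matrix n N C
  by unfold_locales (use C_inj_row n_ge2 in auto)

end

section \<open>Basic solutions of the perturbed system\<close>

context marriage
begin

text \<open>The signs of the bipartition: the two ends of a valid edge cancel.\<close>

definition sg :: "nat \<Rightarrow> real" where
  "sg v = (if v \<le> k then 1 else - 1)"

lemma sg_sq [simp]: "sg v * sg v = 1" by (simp add: sg_def)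

lemma sg_neq_0 [simp]: "sg v \<noteq> 0" by (simp add: sg_def)

lemma A_nonneg: "0 \<le> A v j" by (simp add: matrix_A_def)

lemma A_inc: "inc v j \<Longrightarrow> A v j = 1" by (simp add: matrix_A_def)

lemma sum_A_col:
  assumes "finite S"
  shows "(\<Sum>v\<in>S. f v * A v j) = (\<Sum>v\<in>S \<inter> ends k (edge j). f v)"
  using assms by (simp add: matrix_A_def sum.inter_restrict if_distrib cong: if_cong)

lemma sum_A_loop:
  assumes "finite S" "j \<in> {1..n}"
  shows "(\<Sum>v\<in>S. f v * A v j) = (if j \<in> S then f j else 0)"
  using assms by (simp add: sum_A_col edge_loop)

lemma sum_A_valid:
  assumes "finite S" "edge j = Valid a b" "a \<in> {1..k}" "b \<in> {1..k}"
  shows "(\<Sum>v\<in>S. f v * A v j) = (if a \<in> S then f a else 0) + (if k + b \<in> S then f (k + b) else 0)"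
proof -
  have "a \<noteq> k + b" using assms by auto
  then show ?thesis
    using assms by (cases "a \<in> S"; cases "k + b \<in> S") (simp_all add: sum_A_col Int_insert_right)
qed

text \<open>
  A row \<open>z\<close> of the inverse of a basis has constant \<open>sg v * z v\<close> along every valid edge of the basis
  other than \<open>j\<close>, so the restriction of \<open>z\<close> to a level set of \<open>sg v * z v\<close> is again such a row.
\<close>

lemma dual_set_exists:
  assumes B: "B \<subseteq> {1..N}" "card B = n" "lin_indep_cols n A B" "j \<in> B"
  obtains S c where "S \<subseteq> {1..n}" "c = 1 \<or> c = (-1::real)"
    "\<And>h. h \<in> B \<Longrightarrow> c * (\<Sum>v\<in>S. sg v * A v h) = of_bool (h = j)"
proof -
  note result = that
  have fB: "finite B" using B(1) by (rule finite_subset) simp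
  obtain z where z: "\<forall>h\<in>B. (\<Sum>v\<in>{1..n}. z v * A v h) = of_bool (h = j)"
    using dual_row_exists[OF B(3) fB B(2,4)] by blast
  define p where "p v = sg v * z v" for v
  have loop: "z h = of_bool (h = j)" if "h \<in> B" "h \<in> {1..n}" for h
    using z that sum_A_loop[of "{1..n}" h z] by simp
  have valid: "p a - p (k + b) = of_bool (h = j)"
    if "h \<in> B" "edge h = Valid a b" "a \<in> {1..k}" "b \<in> {1..k}" for h a b
  proof -
    have "(\<Sum>v\<in>{1..n}. z v * A v h) = z a + z (k + b)"
      using sum_A_valid[OF _ that(2-4), of "{1..n}" z] that(3,4) by (simp add: n_def)
    then show ?thesis using z that by (simp add: p_def sg_def)
  qed
  \<comment> \<open>A loop of the basis other than \<open>j\<close> has level 0, so a nonzero level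
    \<open>\<alpha>\<close> keeps it out of the level set; a valid edge other than \<open>j\<close>
    has both ends at one level and cancels.\<close>
  have main: thesis if \<alpha>: "\<alpha> \<noteq> 0" and c: "c = 1 \<or> c = (-1::real)"
    and jv: "c * (\<Sum>v\<in>{v\<in>{1..n}. p v = \<alpha>}. sg v * A v j) = 1" for \<alpha> c
  proof (rule result)
    let ?S = "{v\<in>{1..n}. p v = \<alpha>}"
    show "?S \<subseteq> {1..n}" by auto
    show "c = 1 \<or> c = -1" by (rule c)
    fix h assume h: "h \<in> B"
    have hN: "h \<in> {1..N}" using h B by auto
    show "c * (\<Sum>v\<in>?S. sg v * A v h) = of_bool (h = j)"
    proof (cases "h = j")
      case True
      then show ?thesis using jv by simp
    next
      case False
      show ?thesis
      proof (cases "valid_column h")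
        case True
        then obtain a b where ab: "edge h = Valid a b" "a \<in> {1..k}" "b \<in> {1..k}" by (rule valid_col)
        have "a \<in> {1..n}" "k + b \<in> {1..n}" using ab by (auto simp: n_def)
        then have "a \<in> ?S \<longleftrightarrow> k + b \<in> ?S" using valid[OF h ab] False by auto
        moreover have "sg a = 1" "sg (k + b) = -1" using ab by (auto simp: sg_def)
        ultimately have "(\<Sum>v\<in>?S. sg v * A v h) = 0" using sum_A_valid[OF _ ab, of ?S sg] by simp
        then show ?thesis using False by simp
      next
        case nv: False
        then have hn: "h \<in> {1..n}" using not_valid_column[OF hN] by blast
        then have "h \<notin> ?S" using loop[OF h hn] False \<alpha> by (simp add: p_def)
        then have "(\<Sum>v\<in>?S. sg v * A v h) = 0" using sum_A_loop[OF _ hn, of ?S sg] by simp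
        then show ?thesis using False by simp
      qed
    qed
  qed
  have jN: "j \<in> {1..N}" using B by auto
  show thesis
  proof (cases "valid_column j")
    case True
    then obtain a b where ab: "edge j = Valid a b" "a \<in> {1..k}" "b \<in> {1..k}" by (rule valid_col)
    have ab_n: "a \<in> {1..n}" "k + b \<in> {1..n}" and s: "sg a = 1" "sg (k + b) = -1"
      using ab by (auto simp: n_def sg_def)
    have pd: "p a - p (k + b) = 1" using valid[OF B(4) ab] by simp
    show thesis
    \<comment> \<open>The levels of the two ends of \<open>j\<close> differ by 1, so one of them is
      nonzero. The man's end gives the sign \<open>c = 1\<close>; if its level is 0, the woman's end
      has level -1 and gives \<open>c = -1\<close>.\<close>
    proof (cases "p a = 0")
      case False
      show thesis
        by (rule main[of "p a" 1]) (use sum_A_valid[OF _ ab, of "{v\<in>{1..n}. p v = p a}" sg] ab_n s pd False in auto)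
    next
      case 0: True
      show thesis
        by (rule main[of "-1" "-1"]) (use sum_A_valid[OF _ ab, of "{v\<in>{1..n}. p v = -1}" sg] ab_n s pd 0 in auto)
    qed
  next
    case False
    then have jn: "j \<in> {1..n}" using not_valid_column[OF jN] by blast
    then have "p j = sg j" using loop[OF B(4) jn] by (simp add: p_def)
    then show thesis
      by (intro main[of "sg j" "sg j"])
        (use sum_A_loop[OF _ jn, of "{v\<in>{1..n}. p v = sg j}" sg] jn in \<open>auto simp: sg_def\<close>)
  qed
qed

text \<open>What matters is \<open>k * eps < 1\<close>: then the women's perturbations, each at most
  \<open>eps\<close>, sum to less than 1, and the men's, each at most \<open>eps ^ (k + 1)\<close>,
  sum to less than \<open>eps ^ k\<close>, the least perturbation of a woman.\<close>

definition eps :: real where "eps = 1 / (real k + 1)"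

definition bp :: "nat \<Rightarrow> real" where "bp = (\<lambda>i. rhs_b i + perturbation k eps i)"

lemma eps_bounds: "0 < eps" "eps < 1" "real k * eps < 1"
  using k_pos by (simp_all add: eps_def field_simps)

lemma sum_sg:
  assumes "finite S"
  shows "(\<Sum>v\<in>S. sg v * g v) = (\<Sum>v\<in>{v\<in>S. v \<le> k}. g v) - (\<Sum>v\<in>{v\<in>S. \<not> v \<le> k}. g v)"
proof -
  have "(\<Sum>v\<in>S. sg v * g v) = (\<Sum>v\<in>S. if v \<le> k then g v else - g v)"
    by (rule sum.cong) (auto simp: sg_def)
  also have "\<dots> = (\<Sum>v\<in>S \<inter> {v. v \<le> k}. g v) + (\<Sum>v\<in>S \<inter> - {v. v \<le> k}. - g v)"
    using assms by (rule sum.If_cases)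
  also have "S \<inter> {v. v \<le> k} = {v\<in>S. v \<le> k}" by auto
  also have "S \<inter> - {v. v \<le> k} = {v\<in>S. \<not> v \<le> k}" by auto
  finally show ?thesis by (simp add: sum_negf)
qed

text \<open>A nonempty balanced set contains a woman, and she alone outweighs all its men together.
  The bound 1 keeps the perturbation from overruling a nonzero integer.\<close>

lemma perturbation_sum:
  assumes "S \<subseteq> {1..n}"
  shows "\<bar>\<Sum>v\<in>S. sg v * perturbation k eps v\<bar> < 1"
    and "S \<noteq> {} \<Longrightarrow> (\<Sum>v\<in>S. sg v) = 0 \<Longrightarrow> (\<Sum>v\<in>S. sg v * perturbation k eps v) < 0"
proof -
  have fS: "finite S" using assms by (rule finite_subset) simp
  let ?M = "{v\<in>S. v \<le> k}" and ?W = "{v\<in>S. \<not> v \<le> k}"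
  let ?g = "perturbation k eps"
  note e = eps_bounds
  have M: "card ?M \<le> k" using card_mono[of "{1..k}" ?M] assms by force
  have W: "card ?W \<le> k" using card_mono[of "{k+1..2*k}" ?W] assms by (force simp: n_def)
  have gpos: "0 < ?g v" for v using e by (simp add: perturbation_def)
  have "?g v \<le> eps ^ (k + 1)" if "v \<in> ?M" for v
    using that assms e by (auto simp: perturbation_def simp del: power_Suc intro!: power_decreasing)
  then have "(\<Sum>v\<in>?M. ?g v) \<le> of_nat (card ?M) * eps ^ (k + 1)" by (rule sum_bounded_above)
  also have "\<dots> \<le> real k * eps ^ (k + 1)" using M e by (intro mult_right_mono) auto
  also have "\<dots> = (real k * eps) * eps ^ k" by simp
  also have "\<dots> < 1 * eps ^ k" using e by (intro mult_strict_right_mono) auto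
  finally have Ms: "(\<Sum>v\<in>?M. ?g v) < eps ^ k" by simp
  have "?g v \<le> eps" if "v \<in> ?W" for v
    using that e power_decreasing[of 1 "v - k" eps] by (auto simp: perturbation_def)
  then have "(\<Sum>v\<in>?W. ?g v) \<le> of_nat (card ?W) * eps" by (rule sum_bounded_above)
  also have "\<dots> \<le> real k * eps" using W e by (intro mult_right_mono) auto
  finally have Ws: "(\<Sum>v\<in>?W. ?g v) < 1" using e by simp
  have nn: "0 \<le> (\<Sum>v\<in>?M. ?g v)" "0 \<le> (\<Sum>v\<in>?W. ?g v)"
    using gpos by (auto intro!: sum_nonneg simp: less_imp_le)
  have "eps ^ k \<le> 1" using e by (intro power_le_one) auto
  then show "\<bar>\<Sum>v\<in>S. sg v * ?g v\<bar> < 1" using Ms Ws nn unfolding sum_sg[OF fS] by linarith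
  assume ne: "S \<noteq> {}" and bal: "(\<Sum>v\<in>S. sg v) = 0"
  have "real (card ?M) = real (card ?W)" using sum_sg[OF fS, of "\<lambda>_. 1"] bal by simp
  moreover have "S = ?M \<union> ?W" by auto
  ultimately have "?W \<noteq> {}" using ne fS
    by (metis (no_types, lifting) card_0_eq card.empty finite_subset mem_Collect_eq of_nat_eq_iff subsetI sup_bot.right_neutral)
  then obtain w where w: "w \<in> ?W" by blast
  have "w - k \<le> k" using w assms by (auto simp: n_def)
  then have "eps ^ k \<le> ?g w" using w e by (auto simp: perturbation_def intro: power_decreasing)
  also have "\<dots> \<le> (\<Sum>v\<in>?W. ?g v)" by (rule member_le_sum[OF w]) (use gpos fS in \<open>auto intro: less_imp_le\<close>)
  finally show "(\<Sum>v\<in>S. sg v * ?g v) < 0" using Ms unfolding sum_sg[OF fS] by linarith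
qed

lemma basic_sol_dual:
  assumes B: "B \<subseteq> {1..N}" "card B = n" "lin_indep_cols n A B" "j \<in> B"
    and S: "S \<subseteq> {1..n}" "\<And>h. h \<in> B \<Longrightarrow> c * (\<Sum>v\<in>S. sg v * A v h) = of_bool (h = j)"
  shows "basic_sol n A \<beta> B j = c * (\<Sum>v\<in>S. sg v * \<beta> v)"
proof -
  have fB: "finite B" using B(1) by (rule finite_subset) simp
  let ?x = "basic_sol n A \<beta> B"
  have "c * (\<Sum>v\<in>S. sg v * \<beta> v) = (\<Sum>h\<in>B. c * (\<Sum>v\<in>S. sg v * A v h) * ?x h)"
    unfolding sum_left_mult_solves[OF basic_sol_solves[OF B(3) fB B(2)] S(1), of sg \<beta>]
    by (subst sum_distrib_left) (simp only: mult.assoc)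
  also have "\<dots> = (\<Sum>h\<in>B. of_bool (h = j) * ?x h)" using S(2) by (intro sum.cong) auto
  also have "\<dots> = (\<Sum>h\<in>B. if h = j then ?x h else 0)" by (rule sum.cong) auto
  also have "\<dots> = ?x j" using fB B(4) by simp
  finally show ?thesis by simp
qed

text \<open>Up to the sign \<open>c\<close>, the perturbed value is an integer \<open>I\<close>,
  which gives the original value, plus a term \<open>P\<close> of absolute value below 1. So a
  nonzero \<open>I\<close> decides the sign, and for \<open>I = 0\<close> the negative
  \<open>P\<close> does; nonnegativity then forces \<open>c = -1\<close>, which is the certificate
  in the last claim.\<close>

lemma basic_sol_signs:
  assumes B: "B \<subseteq> {1..N}" "card B = n" "lin_indep_cols n A B" "j \<in> B"
  shows "basic_sol n A bp B j \<noteq> 0"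
    and "basic_sol n A bp B j \<ge> 0 \<Longrightarrow> basic_sol n A rhs_b B j \<ge> 0"
    and "basic_sol n A bp B j \<ge> 0 \<Longrightarrow> basic_sol n A rhs_b B j = 0 \<Longrightarrow>
      \<exists>S\<subseteq>{1..n}. \<forall>h\<in>B. (\<Sum>v\<in>S. sg v * A v h) = - of_bool (h = j)"
proof -
  obtain S c where S: "S \<subseteq> {1..n}" and c: "c = 1 \<or> c = (-1::real)"
    and d: "\<And>h. h \<in> B \<Longrightarrow> c * (\<Sum>v\<in>S. sg v * A v h) = of_bool (h = j)"
    using dual_set_exists[OF B] by blast
  define I where "I = (\<Sum>v\<in>S. sg v)"
  define P where "P = (\<Sum>v\<in>S. sg v * perturbation k eps v)"
  have "S \<noteq> {}" using d[OF B(4)] by auto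
  then have P: "\<bar>P\<bar> < 1" "I = 0 \<Longrightarrow> P < 0" using perturbation_sum[OF S] by (auto simp: I_def P_def)
  have x0: "basic_sol n A rhs_b B j = c * I"
    using basic_sol_dual[OF B S d] by (simp add: I_def rhs_b_def)
  have x1: "basic_sol n A bp B j = c * (I + P)"
    using basic_sol_dual[OF B S d] by (simp add: I_def P_def bp_def rhs_b_def algebra_simps sum.distrib)
  have "I = of_int (\<Sum>v\<in>S. if v \<le> k then 1 else -1)"
    by (simp add: I_def sg_def of_int_sum if_distrib cong: if_cong)
  then obtain q :: int where q: "I = of_int q" by blast
  have qI: "I = 0 \<or> I \<ge> 1 \<or> I \<le> -1"
  proof -
    have "q = 0 \<or> q \<ge> 1 \<or> q \<le> -1" by linarith
    then show ?thesis unfolding q by auto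
  qed
  have "I + P \<noteq> 0" using P qI by auto
  then show "basic_sol n A bp B j \<noteq> 0" using x1 c by auto
  assume x: "basic_sol n A bp B j \<ge> 0"
  then show "basic_sol n A rhs_b B j \<ge> 0" using x0 x1 c P qI by auto
  assume "basic_sol n A rhs_b B j = 0"
  then have "I = 0" using x0 c by auto
  then have "c = -1" using x x1 c P by auto
  then have "\<forall>h\<in>B. (\<Sum>v\<in>S. sg v * A v h) = - of_bool (h = j)"
    using d by (metis minus_minus mult_minus1)
  then show "\<exists>S\<subseteq>{1..n}. \<forall>h\<in>B. (\<Sum>v\<in>S. sg v * A v h) = - of_bool (h = j)" using S by blast
qed

lemma nondegenerate_bp: "nondegenerate n N A bp"
  unfolding nondegenerate_def
proof (intro allI impI ballI)
  fix B j assume "feasible_basis n N A bp B" "j \<in> B"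
  then show "0 < basic_sol n A bp B j"
    using basic_sol_signs(1)[of B j] by (auto simp: feasible_basis_def order_less_le)
qed

lemma feasible_bp_imp_feasible_rhs_b:
  "feasible_basis n N A bp B \<Longrightarrow> feasible_basis n N A rhs_b B"
  unfolding feasible_basis_def using basic_sol_signs(2)[of B] by blast

text \<open>The certificate of a zero value would have signed sum -1 at the loop, but the loop of a
  man contributes only 0 or +1.\<close>

lemma man_loop_pos:
  assumes "feasible_basis n N A bp B" "i \<in> B" "i \<in> {1..k}"
  shows "basic_sol n A rhs_b B i > 0"
proof (rule ccontr)
  assume "\<not> ?thesis"
  moreover have "basic_sol n A rhs_b B i \<ge> 0"
    using feasible_bp_imp_feasible_rhs_b[OF assms(1)] assms(2) by (simp add: feasible_basis_def)
  ultimately have "basic_sol n A rhs_b B i = 0" by simp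
  then obtain S where S: "S \<subseteq> {1..n}" "\<forall>h\<in>B. (\<Sum>v\<in>S. sg v * A v h) = - of_bool (h = i)"
    using basic_sol_signs(3)[of B i] assms by (auto simp: feasible_basis_def)
  have fS: "finite S" using S(1) by (rule finite_subset) simp
  have "i \<in> {1..n}" using assms by (auto simp: n_def)
  then have "(\<Sum>v\<in>S. sg v * A v i) = (if i \<in> S then 1 else 0)"
    using sum_A_loop[OF fS, of i sg] assms by (simp add: sg_def)
  moreover have "(\<Sum>v\<in>S. sg v * A v i) = - 1" using S assms(2) by simp
  ultimately show False by (simp split: if_splits)
qed


text \<open>
  For a kernel vector \<open>x\<close>, the numbers \<open>sg u * x (d u)\<close> form a flow along \<open>d\<close> (each \<open>u\<close> sends its
  value to the other end of \<open>d u\<close>) whose only source is \<open>i\<close>. The negative part of the flow is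
  again a flow, hence yields a kernel vector; it vanishes at \<open>d m\<close>, so it is zero.
\<close>

lemma flow_nonneg:
  assumes E: "E \<subseteq> {1..N}" and i: "i \<in> {1..k}" "i \<in> E"
    and bij: "bij_betw d {1..n} (E - {i})" and incd: "\<And>v. v \<in> {1..n} \<Longrightarrow> inc v (d v)"
    and m: "m \<in> {1..k}" and li: "lin_indep_cols n A (E - {d m})"
    and x: "solves n A (\<lambda>_. 0) E x" "x (d m) = 1"
    and u: "u \<in> {1..n}"
  shows "0 \<le> sg u * x (d u)"
proof -
  \<comment> \<open>The agents whose flow along their assigned edge arrives at
    \<open>u\<close>.\<close>
  define Nb where "Nb u = {u' \<in> {1..n}. u' \<noteq> u \<and> inc u (d u')}" for u
  have Nbf: "finite (Nb u)" for u by (simp add: Nb_def)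
  have fE: "finite E" using E by (rule finite_subset) simp
  have i_n: "i \<in> {1..n}" using i by (auto simp: n_def)
  have dE: "d u \<in> E" "d u \<noteq> i" if "u \<in> {1..n}" for u using bij that by (auto simp: bij_betw_def)
  have dN: "d u \<in> {1..N}" if "u \<in> {1..n}" for u using dE(1)[OF that] E by blast
  have opposite: "sg u * sg u' = -1" if u: "u \<in> {1..n}" and u': "u' \<in> Nb u" for u u'
  proof -
    have u'n: "u' \<in> {1..n}" and ne: "u' \<noteq> u" "inc u (d u')" using u' by (auto simp: Nb_def)
    have "valid_column (d u')"
    proof (rule ccontr)
      assume "\<not> valid_column (d u')"
      then have "d u' \<in> {1..n}" using not_valid_column[OF dN[OF u'n]] by blast
      then show False using inc_loop[of "d u'"] incd[OF u'n] ne by simp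
    qed
    then obtain a b where "edge (d u') = Valid a b" "a \<in> {1..k}" "b \<in> {1..k}" by (rule valid_col)
    then show ?thesis using incd[OF u'n] ne by (auto simp: sg_def)
  qed
  \<comment> \<open>Row \<open>u\<close> times its sign: outflow minus inflow, corrected at the
    source. The inflow changes sign because an edge joins a man and a woman.\<close>
  have conserve: "sg u * (\<Sum>h\<in>E. A u h * y h) =
      sg u * y (d u) - (\<Sum>u'\<in>Nb u. sg u' * y (d u')) + (if u = i then y i else 0)"
    if u: "u \<in> {1..n}" for u y
  proof -
    have "(\<Sum>h\<in>E. A u h * y h) = A u i * y i + (\<Sum>h\<in>E - {i}. A u h * y h)"
      using fE i by (simp add: sum.remove)
    also have "(\<Sum>h\<in>E - {i}. A u h * y h) = (\<Sum>u'\<in>{1..n}. A u (d u') * y (d u'))"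
      using sum.reindex_bij_betw[OF bij, of "\<lambda>h. A u h * y h"] by simp
    also have "\<dots> = A u (d u) * y (d u) + (\<Sum>u'\<in>{1..n} - {u}. A u (d u') * y (d u'))"
      using u by (simp add: sum.remove)
    also have "(\<Sum>u'\<in>{1..n} - {u}. A u (d u') * y (d u')) = (\<Sum>u'\<in>Nb u. y (d u'))"
    proof -
      have "(\<Sum>u'\<in>{1..n} - {u}. A u (d u') * y (d u')) = (\<Sum>u'\<in>Nb u. A u (d u') * y (d u'))"
        by (rule sum.mono_neutral_right) (auto simp: Nb_def matrix_A_def)
      also have "\<dots> = (\<Sum>u'\<in>Nb u. y (d u'))"
        by (rule sum.cong) (auto simp: Nb_def matrix_A_def)
      finally show ?thesis .
    qed
    also have "A u (d u) = 1" using incd[OF u] by (rule A_inc)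
    also have "A u i = (if u = i then 1 else 0)" using inc_loop[OF i_n] by (simp add: matrix_A_def)
    finally have "sg u * (\<Sum>h\<in>E. A u h * y h) =
        (if u = i then sg u * y i else 0) + sg u * y (d u) + sg u * (\<Sum>u'\<in>Nb u. y (d u'))"
      by (simp add: algebra_simps)
    moreover have "sg u * (\<Sum>u'\<in>Nb u. y (d u')) = - (\<Sum>u'\<in>Nb u. sg u' * y (d u'))"
    proof -
      have "sg u * y (d u') = - (sg u' * y (d u'))" if "u' \<in> Nb u" for u'
        using opposite[OF u that] by (auto simp: sg_def split: if_splits)
      then show ?thesis by (simp add: sum_distrib_left sum_negf[symmetric])
    qed
    moreover have "sg i = 1" using i by (simp add: sg_def)
    ultimately show ?thesis by simp
  qed
  \<comment> \<open>An edge has at most one other end, so each value is received at most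
    once.\<close>
  have swap: "(\<Sum>u\<in>{1..n}. \<Sum>u'\<in>Nb u. g u') \<le> (\<Sum>u\<in>{1..n}. g u)"
    if g: "\<And>u. 0 \<le> g u" for g :: "nat \<Rightarrow> real"
  proof -
    have "(\<Sum>u\<in>{1..n}. \<Sum>u'\<in>Nb u. g u') = (\<Sum>u\<in>{1..n}. \<Sum>u'\<in>{1..n}. if u' \<noteq> u \<and> inc u (d u') then g u' else 0)"
      unfolding Nb_def by (intro sum.cong refl sum.inter_filter) simp
    also have "\<dots> = (\<Sum>u'\<in>{1..n}. \<Sum>u\<in>{1..n}. if u' \<noteq> u \<and> inc u (d u') then g u' else 0)"
      by (rule sum.swap)
    also have "\<dots> = (\<Sum>u'\<in>{1..n}. real (card {u \<in> {1..n}. u' \<noteq> u \<and> inc u (d u')}) * g u')"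
      by (intro sum.cong refl) (simp add: sum.inter_filter[symmetric])
    also have "\<dots> \<le> (\<Sum>u'\<in>{1..n}. 1 * g u')"
    proof (intro sum_mono mult_right_mono g)
      fix u' assume u': "u' \<in> {1..n}"
      obtain y where "ends k (edge (d u')) \<subseteq> {u', y}"
        using incd[OF u'] by (cases "edge (d u')") auto
      then have "{u \<in> {1..n}. u' \<noteq> u \<and> inc u (d u')} \<subseteq> {y}" by auto
      then have "card {u \<in> {1..n}. u' \<noteq> u \<and> inc u (d u')} \<le> card {y}" by (rule card_mono[rotated]) simp
      then show "real (card {u \<in> {1..n}. u' \<noteq> u \<and> inc u (d u')}) \<le> 1" by simp
    qed
    finally show ?thesis by simp
  qed
  \<comment> \<open>Total inflow never exceeds total outflow. If nobody sends more than arrives,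
    equality therefore holds at every agent.\<close>
  have tight: "g u = (\<Sum>u'\<in>Nb u. g u')"
    if g: "\<And>u. 0 \<le> g u" and le: "\<And>u. u \<in> {1..n} \<Longrightarrow> g u \<le> (\<Sum>u'\<in>Nb u. g u')" and u: "u \<in> {1..n}"
    for g :: "nat \<Rightarrow> real" and u
  proof -
    have "(\<Sum>u\<in>{1..n}. g u) \<le> (\<Sum>u\<in>{1..n}. \<Sum>u'\<in>Nb u. g u')" by (rule sum_mono[OF le])
    then have "(\<Sum>u\<in>{1..n}. g u) = (\<Sum>u\<in>{1..n}. \<Sum>u'\<in>Nb u. g u')" using swap[of g, OF g] by simp
    then show ?thesis by (rule sum_mono_inv[OF _ le u]) simp_all
  qed
  define t where "t u = sg u * x (d u)" for u
  define c where "c = - x i"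
  have t: "t u = (\<Sum>u'\<in>Nb u. t u') + (if u = i then c else 0)" if "u \<in> {1..n}" for u
  proof -
    have "(\<Sum>h\<in>E. A u h * x h) = 0" using x(1) that by (simp add: solves_def)
    then show ?thesis using conserve[OF that, of x] by (simp add: t_def c_def split: if_splits)
  qed
  define tp where "tp u = max 0 (t u)" for u
  define tm where "tm u = max 0 (- t u)" for u
  have tpm: "t u = tp u - tm u" "0 \<le> tp u" "0 \<le> tm u" for u by (auto simp: tp_def tm_def)
  have sum_t: "(\<Sum>u'\<in>Nb u. t u') = (\<Sum>u'\<in>Nb u. tp u') - (\<Sum>u'\<in>Nb u. tm u')" for u
    by (simp add: tpm(1) sum_subtractf)
  have sum_nn: "0 \<le> (\<Sum>u'\<in>Nb u. tp u')" "0 \<le> (\<Sum>u'\<in>Nb u. tm u')" for u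
    by (simp_all add: sum_nonneg tpm)
  \<comment> \<open>For \<open>c \<ge> 0\<close> the source feeds only the positive part, so the
    negative part sends no more than it receives and is tight. For \<open>c < 0\<close> the positive
    part is tight, and subtracting it leaves the source to the negative part.\<close>
  have tm_flow: "tm u = (\<Sum>u'\<in>Nb u. tm u') + (if u = i then max 0 (- c) else 0)"
    if u: "u \<in> {1..n}" for u
  proof (cases "c \<ge> 0")
    case True
    have "tm u \<le> (\<Sum>u'\<in>Nb u. tm u')" if "u \<in> {1..n}" for u
      using t[OF that] sum_t[of u] sum_nn[of u] True by (auto simp: tm_def split: if_splits)
    from tight[OF tpm(3) this u] show ?thesis using True by simp
  next
    case False
    have "tp u \<le> (\<Sum>u'\<in>Nb u. tp u')" if "u \<in> {1..n}" for u
      using t[OF that] sum_t[of u] sum_nn[of u] False by (auto simp: tp_def split: if_splits)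
    from tight[OF tpm(2) this u] have "tp u = (\<Sum>u'\<in>Nb u. tp u')" .
    then show ?thesis using t[OF u] sum_t[of u] tpm(1)[of u] False by (auto split: if_splits)
  qed
  have injd: "inj_on d {1..n}" using bij by (simp add: bij_betw_def)
  \<comment> \<open>Translates the flow \<open>tm\<close> back into a vector on columns; the value
    at \<open>i\<close> supplies its source.\<close>
  define y where "y h = (if h = i then - max 0 (- c) else if h \<in> E then
      sg (the_inv_into {1..n} d h) * tm (the_inv_into {1..n} d h) else 0)" for h
  have yd: "y (d u) = sg u * tm u" if "u \<in> {1..n}" for u
    using dE[OF that] the_inv_into_f_f[OF injd that] by (simp add: y_def)
  have m_n: "m \<in> {1..n}" using m by (auto simp: n_def)
  have "t m = 1" using x(2) m by (simp add: t_def sg_def)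
  then have ym: "y (d m) = 0" using yd[OF m_n] by (simp add: tm_def)
  have "(\<Sum>h\<in>E. A u h * y h) = 0" if u: "u \<in> {1..n}" for u
  proof -
    have T: "sg u' * y (d u') = tm u'" if "u' \<in> {1..n}" for u'
      using yd[OF that] by (simp add: mult.assoc[symmetric])
    then have "(\<Sum>u'\<in>Nb u. sg u' * y (d u')) = (\<Sum>u'\<in>Nb u. tm u')"
      by (intro sum.cong) (auto simp: Nb_def)
    then have "sg u * (\<Sum>h\<in>E. A u h * y h) = 0"
      using conserve[OF u, of y] T[OF u] tm_flow[OF u] by (simp add: y_def split: if_splits)
    then show ?thesis by simp
  qed
  then have "solves n A (\<lambda>_. 0) E y" using i by (auto simp: solves_def y_def)
  then have "solves n A (\<lambda>_. 0) (E - {d m}) y"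
    by (rule solves_subset) (use fE ym in auto)
  then have "y (d u) = 0" using lin_indep_cols_solves_zero[OF li] by blast
  then have "tm u = 0" using yd[OF u] by simp
  then show ?thesis by (simp add: tm_def t_def max_def split: if_splits)
qed

end

section \<open>Structure of the intermediate pairs\<close>

context marriage
begin

section \<open>Feasible bases of the perturbed system and ties in the original one\<close>

lemma bp_pos: "0 < bp v"
  using eps_bounds by (simp add: bp_def rhs_b_def perturbation_def add_pos_pos)

lemma feasible_covers:
  assumes "feasible_basis n N A bp B" "v \<in> {1..n}"
  obtains j where "j \<in> B" "inc v j"
proof -
  have "(\<Sum>j\<in>B. A v j * basic_sol n A bp B j) = bp v"
    using feasible_basis_solves[OF assms(1)] assms(2) by (simp add: solves_def)
  then have "(\<Sum>j\<in>B. A v j * basic_sol n A bp B j) \<noteq> 0" using bp_pos[of v] by simp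
  then obtain j where "j \<in> B" "A v j * basic_sol n A bp B j \<noteq> 0" by (meson sum.neutral)
  then show thesis using that by (auto simp: matrix_A_def split: if_splits)
qed

text \<open>In the original system the total value of the men's loops equals that of the women's
  loops, since valid edges cancel in the signed sum of all rows. The first man's loop has positive
  value, so some woman's loop must balance it.\<close>

lemma feasible_woman_loop:
  assumes fe: "feasible_basis n N A bp B" and 1: "1 \<in> B"
  obtains w where "w \<in> {1..n}" "k < w" "w \<in> B"
proof (rule ccontr)
  note result = that
  assume no: "\<not> thesis"
  let ?x = "basic_sol n A rhs_b B"
  have fe0: "feasible_basis n N A rhs_b B" by (rule feasible_bp_imp_feasible_rhs_b[OF fe])
  have BN: "B \<subseteq> {1..N}" and x0: "\<And>j. j \<in> B \<Longrightarrow> 0 \<le> ?x j" using fe0 by (auto simp: feasible_basis_def)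
  have fB: "finite B" using BN by (rule finite_subset) simp
  have col: "0 \<le> (\<Sum>v\<in>{1..n}. sg v * A v j)" if j: "j \<in> B" for j
  proof (cases "valid_column j")
    case True
    then obtain a b where ab: "edge j = Valid a b" "a \<in> {1..k}" "b \<in> {1..k}" by (rule valid_col)
    have "sg a = 1" "sg (k + b) = -1" "a \<in> {1..n}" "k + b \<in> {1..n}" using ab by (auto simp: sg_def n_def)
    then show ?thesis using sum_A_valid[OF _ ab, of "{1..n}" sg] by simp
  next
    case False
    then have jn: "j \<in> {1..n}" using not_valid_column j BN by blast
    then have "j \<le> k" using no result[OF jn _ j] by (meson not_le)
    then show ?thesis using sum_A_loop[OF _ jn, of "{1..n}" sg] jn by (simp add: sg_def)
  qed
  have one: "1 \<in> {1..k}" "1 \<in> {1..n}" using k_pos by (auto simp: n_def)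
  have "(\<Sum>v\<in>{1..n}. sg v * A v 1) = 1"
    using sum_A_loop[OF _ one(2), of "{1..n}" sg] one by (simp add: sg_def)
  then have "0 < (\<Sum>v\<in>{1..n}. sg v * A v 1) * ?x 1" using man_loop_pos[OF fe 1 one(1)] by simp
  then have "0 < (\<Sum>j\<in>B. (\<Sum>v\<in>{1..n}. sg v * A v j) * ?x j)"
    using fB 1 col x0 by (intro sum_pos2[of B 1]) auto
  moreover have "(\<Sum>v\<in>{1..n}. sg v * rhs_b v) = (\<Sum>j\<in>B. (\<Sum>v\<in>{1..n}. sg v * A v j) * ?x j)"
    by (rule sum_left_mult_solves[OF feasible_basis_solves[OF fe0]]) simp
  moreover have "(\<Sum>v\<in>{1..n}. sg v * rhs_b v) = 0"
  proof -
    have "{v\<in>{1..n}. v \<le> k} = {1..k}" "{v\<in>{1..n}. \<not> v \<le> k} = {k+1..2*k}" by (auto simp: n_def)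
    then show ?thesis using sum_sg[of "{1..n}" rhs_b] by (simp add: rhs_b_def)
  qed
  ultimately show False by simp
qed

text \<open>If \<open>jl\<close> left instead, loop \<open>i\<close> would stay in a
  perturbed-feasible basis and keep a positive original value. The step for \<open>jl\<close> would
  then be strictly shorter than the step for \<open>i\<close>, which would carry \<open>jl\<close>
  below 0.\<close>

lemma man_loop_candidate_leaves:
  assumes fe: "feasible_basis n N A bp B" and jt: "jt \<notin> B"
    and cl: "candidate n N A bp B jt jl" and ci: "candidate n N A rhs_b B jt i" and i: "i \<in> {1..k}"
  shows "jl = i"
proof (rule ccontr)
  assume ne: "jl \<noteq> i"
  have fB: "finite B" using fe finite_subset[of B "{1..N}"] by (simp add: feasible_basis_def)
  obtain v where v: "solves n A (\<lambda>_. 0) (insert jt B) v" "v jt = 1"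
    using pivot_direction_exists[of n A B jt] fe fB jt by (auto simp: feasible_basis_def)
  note fe0 = feasible_bp_imp_feasible_rhs_b[OF fe]
  have fe2: "feasible_basis n N A bp (insert jt (B - {jl}))" and jlB: "jl \<in> B" and iB: "i \<in> B"
    using cl ci by (auto simp: candidate_def)
  have cl0: "candidate n N A rhs_b B jt jl"
    using feasible_bp_imp_feasible_rhs_b[OF fe2] jlB by (simp add: candidate_def)
  note li = candidate_solution_on_line[OF fe0 ci jt v]
  note ll = candidate_solution_on_line[OF fe0 cl0 jt v]
  let ?x = "basic_sol n A rhs_b B"
  let ?xi = "basic_sol n A rhs_b (insert jt (B - {i}))" and ?xl = "basic_sol n A rhs_b (insert jt (B - {jl}))"
  have "0 < ?x i" by (rule man_loop_pos[OF fe iB i])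
  have "0 < ?xl i" by (rule man_loop_pos[OF fe2 _ i]) (use iB ne in auto)
  have "?xi jt * v i < 0" using li(1)[of i] li(2) \<open>0 < ?x i\<close> by linarith
  then have vi: "v i < 0" using li(4) by (simp add: mult_less_0_iff)
  have "?xi jt * v i < ?xl jt * v i" using li(1)[of i] li(2) ll(1)[of i] \<open>0 < ?xl i\<close> by linarith
  then have lt: "?xl jt < ?xi jt" using vi by (simp add: mult_less_cancel_right)
  have vl: "v jl < 0" by (rule nondegenerate_candidate_direction[OF nondegenerate_bp fe cl jt v])
  have "?xi jl \<ge> 0" using ci jlB ne by (auto simp: candidate_def feasible_basis_def)
  then have "?xl jt * v jl \<le> ?xi jt * v jl" using ll(1)[of jl] ll(2) li(1)[of jl] by linarith
  then show False using lt vl by (simp add: mult_le_cancel_right)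
qed

text \<open>A second decreasing candidate \<open>j\<close> would have value 0 after the pivot. Its
  certificate, paired with the kernel vector \<open>v\<close>, gives 0 as \<open>- v j\<close> plus
  either 0 or \<open>- v jl\<close>; both \<open>v j\<close> and \<open>v jl\<close> are
  negative.\<close>

lemma woman_loop_leaves_no_tie:
  assumes fe: "feasible_basis n N A bp B" and jt: "jt \<notin> B"
    and v: "solves n A (\<lambda>_. 0) (insert jt B) v" "v jt = 1"
    and cl: "candidate n N A bp B jt jl" and jl: "jl \<in> {1..n}" "k < jl"
    and cj: "candidate n N A rhs_b B jt j" and j: "j \<noteq> jl" "v j \<le> 0"
  shows False
proof -
  have fB: "finite B" using fe finite_subset[of B "{1..N}"] by (simp add: feasible_basis_def)
  note fe0 = feasible_bp_imp_feasible_rhs_b[OF fe]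
  let ?B' = "insert jt (B - {jl})"
  have fe2: "feasible_basis n N A bp ?B'" and jlB: "jl \<in> B" and jB: "j \<in> B"
    using cl cj by (auto simp: candidate_def)
  have cl0: "candidate n N A rhs_b B jt jl"
    using feasible_bp_imp_feasible_rhs_b[OF fe2] jlB by (simp add: candidate_def)
  note lj = candidate_solution_on_line[OF fe0 cj jt v]
  note ll = candidate_solution_on_line[OF fe0 cl0 jt v]
  let ?x = "basic_sol n A rhs_b B"
  let ?xj = "basic_sol n A rhs_b (insert jt (B - {j}))" and ?xl = "basic_sol n A rhs_b ?B'"
  have vj: "v j < 0" using lj(3) j by simp
  have vl: "v jl < 0" by (rule nondegenerate_candidate_direction[OF nondegenerate_bp fe cl jt v])
  have jB': "j \<in> ?B'" using jB j by simp
  have "?xj jl \<ge> 0" using cj jlB j by (auto simp: candidate_def feasible_basis_def)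
  then have "?xl jt * v jl \<le> ?xj jt * v jl" using ll(1)[of jl] ll(2) lj(1)[of jl] by linarith
  then have le: "?xj jt \<le> ?xl jt" using vl by (simp add: mult_le_cancel_right)
  have xlj: "?xl j \<ge> 0" using cl0 jB' by (auto simp: candidate_def feasible_basis_def)
  have "?xl jt * v j \<le> ?xj jt * v j" using le vj by (simp add: mult_le_cancel_right)
  \<comment> \<open>The step for \<open>jl\<close> is at least the step for \<open>j\<close>, so
    \<open>j\<close> has reached 0 already, and feasibility lets it go no further.\<close>
  then have "?xl j = 0" using ll(1)[of j] lj(1)[of j] lj(2) xlj by linarith
  then obtain S where S: "S \<subseteq> {1..n}" "\<forall>h\<in>?B'. (\<Sum>u\<in>S. sg u * A u h) = - of_bool (h = j)"
    using basic_sol_signs(3)[of ?B' j] fe2 jB' by (auto simp: feasible_basis_def)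
  have fS: "finite S" using S(1) by (rule finite_subset) simp
  have E: "insert jt B = insert jl ?B'" using jlB by auto
  have jlB': "jl \<notin> ?B'" using jlB jt by auto
  have "0 = (\<Sum>h\<in>insert jt B. (\<Sum>u\<in>S. sg u * A u h) * v h)"
    using sum_left_mult_solves[OF v(1) S(1), of sg] by simp
  also have "\<dots> = (\<Sum>u\<in>S. sg u * A u jl) * v jl + (\<Sum>h\<in>?B'. (\<Sum>u\<in>S. sg u * A u h) * v h)"
    unfolding E using jlB' fB by (subst sum.insert) auto
  also have "(\<Sum>h\<in>?B'. (\<Sum>u\<in>S. sg u * A u h) * v h) = (\<Sum>h\<in>?B'. if h = j then - v h else 0)"
    using S(2) by (intro sum.cong) auto
  also have "\<dots> = - v j" using fB jB' by simp
  also have "(\<Sum>u\<in>S. sg u * A u jl) = (if jl \<in> S then -1 else 0)"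
    using sum_A_loop[OF fS jl(1), of sg] jl(2) by (simp add: sg_def)
  finally show False using vj vl by (simp split: if_splits)
qed

text \<open>The invariant of the algorithm before termination. It stops when column 1 leaves
  \<open>B\<close> or enters \<open>D\<close>.\<close>

definition aligned :: "nat set \<Rightarrow> nat set \<Rightarrow> nat \<Rightarrow> bool" where
  "aligned B D jt \<longleftrightarrow> feasible_basis n N A bp B \<and> ordinal_basis n N C D \<and>
     B - D = {1} \<and> D - B = {jt}"

lemma alignedD:
  assumes "aligned B D jt"
  shows "feasible_basis n N A bp B" "ordinal_basis n N C D" "1 \<in> B" "1 \<notin> D" "jt \<in> D" "jt \<notin> B"
    "insert jt B = insert 1 D" "B - {1} = D - {jt}"
  using assms by (auto simp: aligned_def)

lemma one_n: "1 \<in> {1..n}" and one_k: "1 \<in> {1..k}" using k_pos by (auto simp: n_def)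

lemma man_in_n: "a \<in> {1..k} \<Longrightarrow> a \<in> {1..n}" by (auto simp: n_def)

lemma aligned_covers:
  assumes "aligned B D jt" "v \<in> {1..n}" "v \<noteq> 1"
  obtains j where "j \<in> D - {jt}" "inc v j"
proof -
  note a = alignedD[OF assms(1)]
  obtain j where j: "j \<in> B" "inc v j" using feasible_covers[OF a(1) assms(2)] by blast
  have "j \<noteq> 1" using inc_loop[OF one_n, of v] j assms(3) by auto
  then show thesis using that[of j] j a(8) by auto
qed

lemma aligned_utility_le:
  assumes "aligned B D jt" "v \<in> {1..n}" "v \<noteq> 1"
  shows "utility C D v \<le> k"
proof -
  note a = alignedD[OF assms(1)]
  obtain j where "j \<in> D - {jt}" "inc v j" using aligned_covers[OF assms] .
  then show ?thesis
    using utility_le[OF ordinal_basisD(2,3)[OF a(2)], of j C v] C_inc_le[of v j] by simp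
qed

lemma inc_worst:
  assumes "ordinal_basis n N C D" "v \<in> {1..n}" "utility C D v \<le> k"
  shows "inc v (worst C D v)"
proof -
  note D = ordinal_basisD[OF assms(1)]
  have "worst C D v \<in> {1..N}" using worst_in[OF D(2,3)] D(1) by blast
  then show ?thesis using C_le_k_iff[OF assms(2), of "worst C D v"] C_worst[OF D(2,3), of C v] assms(3) by metis
qed

lemma worst_loop:
  assumes "ordinal_basis n N C D" "v \<in> {1..n}" "v \<in> D"
  shows "worst C D v = v" "utility C D v = 0"
proof -
  note D = ordinal_basisD[OF assms(1)]
  show u: "utility C D v = 0"
    using utility_le[OF D(2,3) assms(3), of C v] C_loop_self[OF assms(2)] by simp
  then show "worst C D v = v" using worst_eqI[OF assms(2) D(1) assms(3)] C_loop_self[OF assms(2)] by simp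
qed

text \<open>Without column 1 there are only \<open>n - 1\<close> loops, so \<open>D\<close> contains
  a valid edge.\<close>

lemma aligned_utility_1_le:
  assumes "aligned B D jt"
  shows "utility C D 1 \<le> k^2"
proof -
  note a = alignedD[OF assms]
  note D = ordinal_basisD[OF a(2)]
  have "\<exists>j\<in>D. valid_column j"
  proof (rule ccontr)
    assume "\<not> ?thesis"
    then have "D \<subseteq> {1..n} - {1}" using not_valid_column D(1) a(4) by blast
    then have "card D \<le> card ({1..n} - {1})" by (rule card_mono[rotated]) simp
    then show False using D(4) n_ge2 by simp
  qed
  then obtain j where j: "j \<in> D" "valid_column j" by blast
  then show ?thesis using utility_le[OF D(2,3) j(1), of C 1] C_valid_le[OF one_n j(2)] by simp
qed

text \<open>No edge of \<open>D\<close> contains the first man, and his entries then fall from left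
  to right, so he dislikes the rightmost valid edge \<open>e\<close>. If its man \<open>s\<close>
  lacked his loop, \<open>s\<close> would dislike one of his edges, which cannot lie left of
  \<open>e\<close> because left is better for him; so he would dislike \<open>e\<close> too, against
  injectivity.\<close>

lemma aligned_high:
  assumes al: "aligned B D jt" and hi: "k < utility C D 1"
  obtains e s b where "e = worst C D 1" "e \<in> D" "valid_column e" "edge e = Valid s b" "s \<in> {2..k}" "s \<in> D"
    "\<And>j. j \<in> D \<Longrightarrow> valid_column j \<Longrightarrow> j \<le> e"
proof -
  note a = alignedD[OF al]
  note D = ordinal_basisD[OF a(2)]
  define e where "e = worst C D 1"
  have eD: "e \<in> D" and Ce: "C 1 e = utility C D 1"
    using worst_in[OF D(2,3)] C_worst[OF D(2,3), of C 1] by (auto simp: e_def)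
  have eN: "e \<in> {1..N}" using eD D(1) by blast
  have e1: "e \<noteq> 1" using eD a(4) by auto
  have ev: "valid_column e" using C_le_square_iff[OF one_n eN] Ce aligned_utility_1_le[OF al] e1 by simp
  have ni: "\<not> inc 1 j" if "j \<in> D" for j
    using utility_le[OF D(2,3) that, of C 1] C_inc_le[of 1 j] hi by linarith
  have right: "j \<le> e" if j: "j \<in> D" "valid_column j" for j
  proof (rule ccontr)
    assume "\<not> j \<le> e"
    then have "C 1 j < C 1 e"
      using C_noninc_valid_less[OF ev ni[OF eD] j(2) ni[OF j(1)]] by simp
    then show False using utility_le[OF D(2,3) j(1), of C 1] Ce by simp
  qed
  obtain s b where sb: "edge e = Valid s b" "s \<in> {1..k}" "b \<in> {1..k}" using ev by (rule valid_col)
  have s1: "s \<noteq> 1" using ni[OF eD] sb(1) by auto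
  have sn: "s \<in> {1..n}" using man_in_n[OF sb(2)] .
  have se: "inc s e" using sb(1) by simp
  have "s \<in> D"
  proof (rule ccontr)
    assume sD: "s \<notin> D"
    let ?j = "worst C D s"
    have jD: "?j \<in> D" by (rule worst_in[OF D(2,3)])
    have ji: "inc s ?j" by (rule inc_worst[OF a(2) sn aligned_utility_le[OF al sn s1]])
    have jv: "valid_column ?j"
    proof (rule ccontr)
      assume "\<not> valid_column ?j"
      then have "?j \<in> {1..n}" using not_valid_column jD D(1) by blast
      then have "?j = s" using inc_loop[of ?j s] ji by simp
      then show False using jD sD by simp
    qed
    have "\<not> ?j < e"
      using C_man_less[OF sb(2) jv ev ji se] utility_le[OF D(2,3) eD, of C s] C_worst[OF D(2,3), of C s]
      by linarith
    then have "?j = e" using right[OF jD jv] by simp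
    then show False using worst_inj[OF a(2) sn one_n] s1 by (simp add: e_def)
  qed
  then show thesis using that[OF e_def eD ev sb(1) _ _ right] sb(2) s1 by simp
qed

text \<open>Some woman \<open>w\<close> also has her loop in \<open>D\<close>. The edge of
  \<open>a\<close> and \<open>w\<close> must be blocked: its ends have utility 0, and all others
  except the first man have utility at most \<open>k\<close>. So the first man blocks it, and his
  disliked edge does not lie to the right of it. Hence the man of that edge is the
  separator.\<close>

lemma aligned_man_loop:
  assumes al: "aligned B D jt" and a: "a \<in> {2..k}" "a \<in> D"
  shows "k < utility C D 1" and "edge (worst C D 1) = Valid s b \<Longrightarrow> s \<le> a"
proof -
  note p = alignedD[OF al]
  note D = ordinal_basisD[OF p(2)]
  obtain w where w: "w \<in> {1..n}" "k < w" "w \<in> B" using feasible_woman_loop[OF p(1,3)] .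
  have wD: "w \<in> D" using w p(8) k_pos by auto
  have wk: "w - k \<in> {1..k}" using woman_index[OF w(1)] w(2) by simp
  have ak: "a \<in> {1..k}" using a by auto
  have an: "a \<in> {1..n}" by (rule man_in_n[OF ak])
  obtain h where h: "valid_column h" "edge h = Valid a (w - k)" using valid_col_exists[OF ak wk] .
  have ends: "ends k (edge h) = {a, w}" using h w by simp
  have hN: "h \<in> {1..N}" by (rule valid_column_le[OF h(1)])
  obtain r where r: "r \<in> {1..n}" "C r h \<le> utility C D r" using D(5)[OF hN] by blast
  have "r = 1"
  proof (rule ccontr)
    assume r1: "r \<noteq> 1"
    have "C r h \<le> k" using r aligned_utility_le[OF al r(1) r1] by simp
    then have "inc r h" using C_le_k_iff[OF r(1) hN] by simp
    then have "r = a \<or> r = w" using ends by simp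
    then have "utility C D r = 0" using worst_loop(2)[OF p(2)] an w(1) a(2) wD by auto
    then show False using r C_inc_valid_pos[OF r(1) h(1) \<open>inc r h\<close>] by simp
  qed
  then have C1: "C 1 h \<le> utility C D 1" using r by simp
  have nh: "\<not> inc 1 h" using ends a w k_pos by auto
  show hi: "k < utility C D 1" using C_noninc_gt[OF h(1) nh] C1 by simp
  assume sb: "edge (worst C D 1) = Valid s b"
  obtain e s' b' where e: "e = worst C D 1" "e \<in> D" "valid_column e" "edge e = Valid s' b'" "s' \<in> {2..k}"
    using aligned_high[OF al hi] by metis
  have ne: "\<not> inc 1 e"
  proof
    assume "inc 1 e"
    then have "C 1 e \<le> k" by (rule C_inc_le)
    then show False using C_worst[OF D(2,3), of C 1] e(1) hi by simp
  qed
  have "\<not> h < e" using C_noninc_valid_less[OF h(1) nh e(3) ne] C1 C_worst[OF D(2,3), of C 1] e(1) by auto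
  then have "e = h \<or> before (edge e) (edge h)" using edge_before[OF valid_column_le[OF e(3)] hN] by linarith
  then show "s \<le> a" using sb h(2) e(1) by auto
qed


definition state :: "nat set \<Rightarrow> nat set \<Rightarrow> nat \<Rightarrow> bool" where
  "state B D jt \<longleftrightarrow> aligned B D jt \<and> valid_column jt \<and> (\<exists>m\<in>{1..k}. worst C D m = jt)"

text \<open>What the ordinal pivot must know about \<open>i\<close>: once loop \<open>i\<close>
  leaves with \<open>i \<noteq> 1\<close>, the worst column left for \<open>i\<close> is the edge
  that the first man dislikes.\<close>

definition anchored :: "nat set \<Rightarrow> nat \<Rightarrow> bool" where
  "anchored D i \<longleftrightarrow> i = 1 \<or> i \<in> D \<and> inc i (worst C D 1) \<and>
     (\<forall>j\<in>D. valid_column j \<longrightarrow> j \<le> worst C D 1) \<and> valid_column (worst C D 1)"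

text \<open>
  Every agent dislikes an edge containing it, unless no edge of \<open>D\<close> contains the first man: then he
  dislikes the rightmost edge, whose man is the separator \<open>s\<close>. In this case \<open>d\<close> assigns that edge to
  \<open>s\<close>, in place of the loop of \<open>s\<close>.
\<close>

lemma state_root:
  assumes st: "state B D jt"
  obtains i d m where
    "if utility C D 1 \<in> {k+1..k^2} then is_separator k D i else i = 1"
    "i \<in> {1..k}" "i \<in> B" "bij_betw d {1..n} (insert jt B - {i})"
    "\<forall>v\<in>{1..n}. inc v (d v)" "\<forall>v>k. d v = worst C D v"
    "m \<in> {1..k}" "d m = jt"
    "anchored D i"
proof -
  have al: "aligned B D jt" and jtv: "valid_column jt" using st by (auto simp: state_def)
  obtain m where m: "m \<in> {1..k}" "worst C D m = jt" using st by (auto simp: state_def)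
  note p = alignedD[OF al]
  note D = ordinal_basisD[OF p(2)]
  have incw: "inc v (worst C D v)" if "v \<in> {1..n}" "v \<noteq> 1" for v
    by (rule inc_worst[OF p(2) that(1) aligned_utility_le[OF al that]])
  show thesis
  proof (cases "k < utility C D 1")
    case False
    have bij: "bij_betw (worst C D) {1..n} (insert jt B - {1})"
    proof -
      have "insert jt B - {1} = D" using p(4,7) by auto
      then show ?thesis using worst_bij[OF p(2)] by simp
    qed
    show thesis
    proof (rule that[of 1 "worst C D" m])
      show "if utility C D 1 \<in> {k+1..k^2} then is_separator k D 1 else 1 = (1::nat)" using False by simp
      show "\<forall>v\<in>{1..n}. inc v (worst C D v)"
      proof
        fix v assume v: "v \<in> {1..n}"
        show "inc v (worst C D v)"
          using incw[OF v] inc_worst[OF p(2) v] False by (cases "v = 1") auto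
      qed
    qed (use bij m one_k p(3) in \<open>auto simp: anchored_def\<close>)
  next
    case True
    obtain e s b where e: "e = worst C D 1" "e \<in> D" "valid_column e" "edge e = Valid s b" "s \<in> {2..k}" "s \<in> D"
      and right: "\<And>j. j \<in> D \<Longrightarrow> valid_column j \<Longrightarrow> j \<le> e"
      using aligned_high[OF al True] by metis
    have sk: "s \<in> {1..k}" and s1: "s \<noteq> 1" using e(5) by auto
    have sn: "s \<in> {1..n}" by (rule man_in_n[OF sk])
    have es: "e \<noteq> s" using e(3) sn by (auto simp: valid_column_def)
    have ws: "worst C D s = s" by (rule worst_loop(1)[OF p(2) sn e(6)])
    have sep: "is_separator k D s"
      unfolding is_separator_def
    proof (intro conjI ballI impI)
      fix i' assume "i' \<in> {2..k}" "i' \<in> D"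
      then show "s \<le> i'" using aligned_man_loop(2)[OF al, of i' s b] e(1,4) by simp
    qed (use e in auto)
    \<comment> \<open>The first man, who has no edge in \<open>D\<close>, receives loop 1. The range
      of \<open>d\<close> is thus \<open>D\<close> with loop \<open>s\<close> replaced by loop 1,
      which frees loop \<open>s\<close> to be the source.\<close>
    define d where "d v = (if v = 1 then 1 else if v = s then e else worst C D v)" for v
    have Dset: "insert jt B - {s} = insert 1 (D - {s})" using p(7) s1 by auto
    have im: "d ` {1..n} = insert 1 (D - {s})"
    proof
      show "d ` {1..n} \<subseteq> insert 1 (D - {s})"
      proof
        fix j assume "j \<in> d ` {1..n}"
        then obtain v where v: "v \<in> {1..n}" "j = d v" by blast
        have "worst C D v \<in> D" by (rule worst_in[OF D(2,3)])
        moreover have "worst C D v \<noteq> s" if "v \<noteq> s" using worst_inj[OF p(2) v(1) sn] ws that by auto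
        ultimately show "j \<in> insert 1 (D - {s})" using v e(2) es by (auto simp: d_def)
      qed
      show "insert 1 (D - {s}) \<subseteq> d ` {1..n}"
      proof
        fix j assume "j \<in> insert 1 (D - {s})"
        then consider "j = 1" | "j \<in> D" "j \<noteq> s" by blast
        then show "j \<in> d ` {1..n}"
        proof cases
          case 1
          then have "j = d 1" by (simp add: d_def)
          then show ?thesis using one_n by blast
        next
          case 2
          obtain v where v: "v \<in> {1..n}" "worst C D v = j" using worst_surj[OF p(2) 2(1)] by blast
          show ?thesis
          proof (cases "v = 1")
            case True
            then have "j = d s" using v e(1) s1 by (simp add: d_def)
            then show ?thesis using sn by blast
          next
            case False
            moreover have "v \<noteq> s" using v 2(2) ws by auto
            ultimately have "j = d v" using v by (simp add: d_def)
            then show ?thesis using v by blast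
          qed
        qed
      qed
    qed
    have "card (insert 1 (D - {s})) = n" using D(2,4) p(4) e(6) n_ge2 by simp
    then have inj: "inj_on d {1..n}" using im by (intro eq_card_imp_inj_on) auto
    \<comment> \<open>If the first man dislikes the entering column, that column is
      \<open>e\<close>, which \<open>d\<close> has handed over to \<open>s\<close>.\<close>
    define m' where "m' = (if m = 1 then s else m)"
    have ms: "m \<noteq> s"
    proof
      assume "m = s"
      then have "jt = s" using m ws by simp
      then show False using jtv sn by (auto simp: valid_column_def)
    qed
    show thesis
    proof (rule that[of s d m'])
      show "if utility C D 1 \<in> {k+1..k^2} then is_separator k D s else s = 1"
        using True aligned_utility_1_le[OF al] sep by simp
      have "s \<noteq> jt" using jtv sn by (auto simp: valid_column_def)
      then have "s \<in> B - {1}" unfolding p(8) using e(6) by blast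
      then show "s \<in> B" by blast
      show "bij_betw d {1..n} (insert jt B - {s})" using inj im Dset by (simp add: bij_betw_def)
      show "\<forall>v\<in>{1..n}. inc v (d v)"
        using incw e(4) inc_loop[OF one_n] by (simp add: d_def)
      show "\<forall>v>k. d v = worst C D v" using sk k_pos by (auto simp: d_def)
      show "m' \<in> {1..k}" "d m' = jt" using m sk s1 ms e(1) by (auto simp: m'_def d_def)
      show "anchored D s" using e right by (auto simp: anchored_def)
    qed (rule sk)
  qed
qed

text \<open>The flow makes the direction nonnegative on the columns assigned to men, so a decreasing
  column is loop \<open>i\<close> or disliked by a woman. The two lemmas on ties then show that the
  perturbed choice respects the priorities of the rule.\<close>

lemma state_leaving:
  assumes st: "state B D jt" and cl: "candidate n N A bp B jt jl"
  obtains i where "i \<in> {1..k}"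
    "anchored D i"
    "jl = i \<or> (\<exists>w\<in>{k+1..n}. worst C D w = jl)"
    "separator_rule k mp wp B D jt jl"
proof -
  have al: "aligned B D jt" using st by (auto simp: state_def)
  note p = alignedD[OF al]
  note D = ordinal_basisD[OF p(2)]
  obtain i d m where sep: "if utility C D 1 \<in> {k+1..k^2} then is_separator k D i else i = 1"
    and i: "i \<in> {1..k}" "i \<in> B" and bij: "bij_betw d {1..n} (insert jt B - {i})"
    and "\<forall>v\<in>{1..n}. inc v (d v)" "\<forall>v>k. d v = worst C D v"
    and m: "m \<in> {1..k}" "d m = jt"
    and i1: "anchored D i"
    using state_root[OF st] .
  then have incd: "\<And>v. v \<in> {1..n} \<Longrightarrow> inc v (d v)" and dw: "\<And>v. k < v \<Longrightarrow> d v = worst C D v"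
    by blast+
  have BN: "B \<subseteq> {1..N}" and li: "lin_indep_cols n A B" and cB: "card B = n"
    using p(1) by (auto simp: feasible_basis_def)
  have fB: "finite B" using BN by (rule finite_subset) simp
  have EN: "insert jt B \<subseteq> {1..N}" using BN p(5) D(1) by auto
  obtain v where v: "solves n A (\<lambda>_. 0) (insert jt B) v" "v jt = 1"
    using pivot_direction_exists[OF li fB cB p(6)] by blast
  have Em: "insert jt B - {d m} = B" using m p(6) by auto
  have flow: "0 \<le> sg u * v (d u)" if "u \<in> {1..n}" for u
    by (rule flow_nonneg[OF EN i(1) _ bij incd m(1) _ v(1) _ that]) (use i li v(2) m Em in simp_all)
  have jlB: "jl \<in> B" using cl by (simp add: candidate_def)
  have vl: "v jl < 0" by (rule nondegenerate_candidate_direction[OF nondegenerate_bp p(1) cl p(6) v])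
  have dis: "jl = i \<or> (\<exists>w\<in>{k+1..n}. worst C D w = jl)"
  proof (cases "jl = i")
    case False
    then have "jl \<in> d ` {1..n}" using jlB bij by (auto simp: bij_betw_def)
    then obtain u where u: "u \<in> {1..n}" "jl = d u" by blast
    have "k < u" using flow[OF u(1)] u(2) vl by (cases "u \<le> k") (auto simp: sg_def)
    then show ?thesis using dw[of u] u by (intro disjI2 bexI[of _ u]) auto
  qed simp
  have cl0: "candidate n N A rhs_b B jt jl"
    using cl feasible_bp_imp_feasible_rhs_b by (simp add: candidate_def)
  have wd: "woman_disliked k C D j \<longleftrightarrow> (\<exists>w\<in>{k+1..n}. worst C D w = j)" for j
  proof -
    have "disliked C D w j \<longleftrightarrow> worst C D w = j" if "w \<in> {k+1..n}" for w
      using disliked_iff[OF _ D(1,3), of w j] that by auto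
    then show ?thesis by (auto simp: woman_disliked_def n_def)
  qed
  have rule_i: "jl = i" if "candidate n N A rhs_b B jt i"
    by (rule man_loop_candidate_leaves[OF p(1,6) cl that i(1)])
  \<comment> \<open>The rule prefers valid edges. If \<open>jl\<close> is a loop, it is the loop of
    the woman who dislikes it, and such a loop does not tie with a woman-disliked valid
    edge.\<close>
  have nv: "is_valid (edge jl)"
    if nc: "\<not> candidate n N A rhs_b B jt i"
      and j: "candidate n N A rhs_b B jt j" "is_valid (edge j)" "woman_disliked k C D j" for j
  proof (rule ccontr)
    assume "\<not> is_valid (edge jl)"
    then have jln: "jl \<in> {1..n}" using is_valid_edge[of jl] not_valid_column[of jl] jlB BN by blast
    have "jl \<noteq> i" using nc cl0 by auto
    then obtain w where w: "w \<in> {k+1..n}" "worst C D w = jl" using dis by blast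
    have wn: "w \<in> {1..n}" "w \<noteq> 1" using w(1) k_pos by auto
    have "inc w jl" using inc_worst[OF p(2) wn(1) aligned_utility_le[OF al wn]] w(2) by simp
    then have kl: "k < jl" using inc_loop[OF jln, of w] w(1) by simp
    obtain w' where w': "w' \<in> {k+1..n}" "worst C D w' = j" using j(3) wd by blast
    have w'n: "w' \<in> {1..n}" "k < w'" using w'(1) by auto
    have vj: "v j \<le> 0" using flow[OF w'n(1)] dw[OF w'n(2)] w'(2) w'n(2) by (simp add: sg_def)
    have "j \<noteq> jl" using j(2) \<open>\<not> is_valid (edge jl)\<close> by auto
    then show False by (rule woman_loop_leaves_no_tie[OF p(1,6) v cl jln kl j(1) _ vj])
  qed
  have "separator_rule k mp wp B D jt jl"
    unfolding separator_rule_def Let_def n_def[symmetric] N_def[symmetric]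
  proof (intro exI conjI)
    show "if utility C D 1 \<in> {k+1..k^2} then is_separator k D i else i = 1" by (rule sep)
    have "woman_disliked k C D jl" if "\<not> candidate n N A rhs_b B jt i"
      using dis that cl0 wd by blast
    then show "if candidate n N A rhs_b B jt i then jl = i
      else if \<exists>j. candidate n N A rhs_b B jt j \<and> is_valid (edge j) \<and> woman_disliked k C D j
        then candidate n N A rhs_b B jt jl \<and> is_valid (edge jl) \<and> woman_disliked k C D jl
        else candidate n N A rhs_b B jt jl \<and> woman_disliked k C D jl"
      using rule_i nv cl0 by (simp split: if_split) blast
  qed
  then show thesis by (rule that[OF i(1) i1 dis])
qed

text \<open>Truncated subtraction loses nothing: in an aligned pair every woman has utility at most
  \<open>k\<close>.\<close>

definition potential :: "nat set \<Rightarrow> nat" where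
  "potential D = utility C D 1 + (\<Sum>w\<in>{k+1..n}. k - utility C D w)"

lemma state_step:
  assumes st: "state B D jt" and cl: "candidate n N A bp B jt jl" and jl1: "jl \<noteq> 1"
  obtains js where "{j \<in> {1..N} - D. ordinal_basis n N C (insert j (D - {jl}))} = {js}"
    "(insert jt (B - {jl}) = insert js (D - {jl})) \<or>
     (state (insert jt (B - {jl})) (insert js (D - {jl})) js \<and>
      potential (insert js (D - {jl})) < potential D)"
proof -
  have al: "aligned B D jt" using st by (auto simp: state_def)
  note p = alignedD[OF al]
  note D = ordinal_basisD[OF p(2)]
  obtain i where i: "i \<in> {1..k}"
    "anchored D i"
    and dis: "jl = i \<or> (\<exists>w\<in>{k+1..n}. worst C D w = jl)"
    and "separator_rule k mp wp B D jt jl"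
    using state_leaving[OF st cl] .
  let ?B' = "insert jt (B - {jl})" and ?D0 = "D - {jl}"
  have jlB: "jl \<in> B" and feB': "feasible_basis n N A bp ?B'" using cl by (auto simp: candidate_def)
  have jlD: "jl \<in> D" "jl \<noteq> jt" using jlB jl1 p(6,8) by auto
  have B': "?B' = insert 1 ?D0" using p(7,8) jlD jl1 p(4,6) by auto
  have cov: "\<exists>j\<in>?D0. inc v j" if v: "v \<in> {1..n}" "v \<noteq> 1" for v
  proof -
    obtain j where j: "j \<in> ?B'" "inc v j" using feasible_covers[OF feB' v(1)] .
    have "j \<noteq> 1" using inc_loop[OF one_n, of v] j v(2) by auto
    then show ?thesis using j B' by auto
  qed
  have D0: "finite ?D0" "?D0 \<subseteq> {1..N}" using D by auto
  have u0: "utility C ?D0 v \<le> k" if v: "v \<in> {1..n}" "v \<noteq> 1" for v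
  proof -
    obtain j where j: "j \<in> ?D0" "inc v j" using cov[OF v] by blast
    then have "?D0 \<noteq> {}" by blast
    from utility_le[OF D0(1) this j(1), of C v] show ?thesis using C_inc_le[OF j(2)] by simp
  qed
  have D0ne: "?D0 \<noteq> {}"
  proof -
    have "2 \<in> {1..n}" using n_ge2 by simp
    then show ?thesis using cov[of 2] by auto
  qed
  have inc0: "inc v (worst C ?D0 v)" if v: "v \<in> {1..n}" "v \<noteq> 1" for v
  proof -
    have "worst C ?D0 v \<in> {1..N}" using worst_in[OF D0(1) D0ne, of C v] D0(2) by blast
    then show ?thesis
      using C_le_k_iff[OF v(1), of "worst C ?D0 v"] C_worst[OF D0(1) D0ne, of C v] u0[OF v] by metis
  qed
  \<comment> \<open>The agent \<open>il\<close> loses its disliked column, and \<open>ir\<close>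
    already dislikes the replacement. If \<open>il\<close> is a woman, the replacement is a valid
    edge containing her; no other woman dislikes it, so \<open>ir\<close> is a man. If loop
    \<open>i\<close> leaves, the replacement is the rightmost edge and \<open>ir\<close> is the
    first man.\<close>
  have "\<exists>il ir. il \<in> {1..n} \<and> worst C D il = jl \<and> ir \<in> {1..k} \<and> worst C D ir = worst C ?D0 il \<and>
      (k < il \<and> valid_column (worst C D ir) \<or> il \<noteq> 1 \<and> ir = 1)"
  proof (cases "jl = i")
    case True
    have i1: "i \<noteq> 1" using True jl1 by simp
    let ?e = "worst C D 1"
    have iD: "i \<in> D" and ie: "inc i ?e" and right: "\<And>j. j \<in> D \<Longrightarrow> valid_column j \<Longrightarrow> j \<le> ?e" and ev: "valid_column ?e"
      using i(2) i1 by (auto simp: anchored_def)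
    have i_n: "i \<in> {1..n}" by (rule man_in_n[OF i(1)])
    let ?r = "worst C ?D0 i"
    have rD: "?r \<in> ?D0" by (rule worst_in[OF D0(1) D0ne])
    have ri: "inc i ?r" by (rule inc0[OF i_n i1])
    have rv: "valid_column ?r"
    proof (rule ccontr)
      assume "\<not> valid_column ?r"
      then have "?r \<in> {1..n}" using not_valid_column rD D(1) by blast
      then have "?r = i" using inc_loop[of ?r i] ri by simp
      then show False using rD True by simp
    qed
    have eD: "?e \<in> ?D0" using worst_in[OF D(2,3), of C 1] ev True i_n by (auto simp: valid_column_def)
    have "\<not> ?r < ?e"
      using C_man_less[OF i(1) rv ev ri ie] utility_le[OF D0(1) D0ne eD, of C i]
        C_worst[OF D0(1) D0ne, of C i] by linarith
    then have "?r = ?e" using right[OF _ rv] rD by auto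
    moreover have "worst C D i = jl" using worst_loop(1)[OF p(2) i_n iD] True by simp
    ultimately show ?thesis using i_n i1 one_k by metis
  next
    case False
    then obtain w where w: "w \<in> {k+1..n}" "worst C D w = jl" using dis by blast
    have wn: "w \<in> {1..n}" "w \<noteq> 1" using w(1) k_pos by auto
    let ?r = "worst C ?D0 w"
    have rD: "?r \<in> ?D0" by (rule worst_in[OF D0(1) D0ne])
    have ri: "inc w ?r" by (rule inc0[OF wn])
    obtain ir where ir: "ir \<in> {1..n}" "worst C D ir = ?r" using worst_surj[OF p(2), of ?r] rD by blast
    have irw: "ir \<noteq> w" using ir(2) rD w(2) by auto
    have rv: "valid_column ?r"
    proof (rule ccontr)
      assume "\<not> valid_column ?r"
      then have "?r \<in> {1..n}" using not_valid_column rD D(1) by blast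
      then have "?r = w" using inc_loop[of ?r w] ri by simp
      then have "worst C D w = w" using worst_loop(1)[OF p(2) wn(1)] rD by simp
      then show False using w(2) rD \<open>?r = w\<close> by simp
    qed
    have "ir \<le> k"
    proof (rule ccontr)
      assume "\<not> ir \<le> k"
      then have irn: "ir \<noteq> 1" "k < ir" using k_pos by auto
      have "inc ir ?r" using inc_worst[OF p(2) ir(1) aligned_utility_le[OF al ir(1) irn(1)]] ir(2) by simp
      moreover obtain a b where "edge ?r = Valid a b" "a \<in> {1..k}" "b \<in> {1..k}" using rv by (rule valid_col)
      ultimately show False using ri irn w(1) irw by auto
    qed
    then show ?thesis using wn w ir rv by (intro exI[of _ w] exI[of _ ir]) auto
  qed
  then obtain il ir where il: "il \<in> {1..n}" "worst C D il = jl" and ir: "ir \<in> {1..k}"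
    and jr: "worst C D ir = worst C ?D0 il" and alt: "k < il \<and> valid_column (worst C D ir) \<or> il \<noteq> 1 \<and> ir = 1"
    by blast
  have irn: "ir \<in> {1..n}" by (rule man_in_n[OF ir])
  have il1: "il \<noteq> 1" using alt k_pos by auto
  have irl: "ir \<noteq> il" using jr il worst_in[OF D0(1) D0ne, of C il] by auto
  \<comment> \<open>The loop of \<open>ir\<close> is the witness for the ordinal pivot: in all other
    rows its entry exceeds \<open>k^2\<close>, which bounds their utilities.\<close>
  have ex: "utility C ?D0 v < C v ir" if v: "v \<in> {1..n} - {ir}" for v
  proof -
    have "utility C ?D0 v \<le> k^2"
    proof (cases "v = 1")
      case False
      then show ?thesis using u0[of v] v k_le_square by simp
    next
      case True
      then have rv: "valid_column (worst C ?D0 il)" using alt jr v by auto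
      show ?thesis
        using utility_le[OF D0(1) D0ne worst_in[OF D0(1) D0ne, of C il], of C v] C_valid_le[OF _ rv, of v] v
        by simp
    qed
    then show ?thesis using C_loop_gt[OF irn, of v] v by simp
  qed
  have irN: "ir \<in> {1..N}" using irn n_le_N by auto
  obtain js where set: "{j \<in> {1..N} - D. ordinal_basis n N C (insert j (D - {jl}))} = {js}"
    and wjs: "worst C (insert js ?D0) ir = js"
    and uir: "utility C (insert js ?D0) ir < utility C D ir"
    and uil: "utility C D il < utility C (insert js ?D0) il"
    and "\<forall>i\<in>{1..n} - {il, ir}. utility C (insert js ?D0) i = utility C D i"
    using ordinal_pivot[OF p(2) il irn jr irN ex] .
  then have uoth: "\<And>i. i \<in> {1..n} - {il, ir} \<Longrightarrow> utility C (insert js ?D0) i = utility C D i"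
    by blast
  let ?D' = "insert js ?D0"
  have js: "js \<in> {1..N}" "js \<notin> D" "ordinal_basis n N C ?D'" using set by auto
  show thesis
  proof (cases "js = 1")
    case True
    then show thesis using that[OF set] B' by simp
  next
    case False
    have al': "aligned ?B' ?D' js"
      unfolding aligned_def
      using feB' js False p(4) B' by auto
    note p' = alignedD[OF al']
    \<comment> \<open>A loop entering here would be that of a man \<open>ir\<close> other than the
      first. The first man's disliked edge would then belong to \<open>ir\<close> after the pivot
      and, his utility being unchanged, also before it. But in that case the loop of
      \<open>ir\<close> was already in \<open>D\<close>.\<close>
    have jsv: "valid_column js"
    proof (rule ccontr)
      assume "\<not> valid_column js"
      then have jsn: "js \<in> {1..n}" using not_valid_column js(1) by blast
      then have "worst C ?D' js = js" using worst_loop(1)[OF js(3) jsn] by simp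
      then have jir: "js = ir" using worst_inj[OF js(3) jsn irn] wjs by simp
      have js2: "js \<in> {2..k}" using jir ir False by auto
      have hi': "k < utility C ?D' 1" by (rule aligned_man_loop(1)[OF al' js2]) simp
      obtain e' s' b' where e': "e' = worst C ?D' 1" "valid_column e'" "edge e' = Valid s' b'"
        and right': "\<And>j. j \<in> ?D' \<Longrightarrow> valid_column j \<Longrightarrow> j \<le> e'"
        using aligned_high[OF al' hi'] by metis
      have "s' \<le> js" using aligned_man_loop(2)[OF al' js2, of s' b'] e' by simp
      moreover have "\<not> s' < js"
      proof
        assume lt: "s' < js"
        obtain j where j: "j \<in> ?D' - {js}" "inc js j" using aligned_covers[OF al' jsn False] .
        have jN: "j \<in> {1..N}" using j D0(2) by auto
        have jv: "valid_column j"
        proof (rule ccontr)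
          assume "\<not> valid_column j"
          then have "j \<in> {1..n}" using not_valid_column[OF jN] by blast
          then show False using inc_loop[of j js] j by simp
        qed
        obtain a b where ab: "edge j = Valid a b" "a \<in> {1..k}" "b \<in> {1..k}" using jv by (rule valid_col)
        have "a = js" using ab j(2) js2 by auto
        then have "before (edge e') (edge j)" using e'(3) ab(1) lt by simp
        then have "e' < j" using edge_less_iff[OF valid_column_le[OF e'(2)] jN] by simp
        then show False using right'[OF _ jv] j by auto
      qed
      ultimately have s'js: "s' = js" by simp
      have u1: "utility C ?D' 1 = utility C D 1" using uoth[of 1] one_n il1 jir False by auto
      have hi: "k < utility C D 1" using hi' u1 by simp
      obtain e s b where e: "e = worst C D 1" "e \<in> D" "valid_column e" "edge e = Valid s b" "s \<in> D"
        using aligned_high[OF al hi] by metis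
      have "C 1 e = C 1 e'"
        using C_worst[OF D(2,3), of C 1] C_worst[OF ordinal_basisD(2,3)[OF js(3)], of C 1] e(1) e'(1) u1 by simp
      then have "e = e'" by (rule C_eq_imp_eq[OF one_n valid_column_le[OF e(3)] valid_column_le[OF e'(2)]])
      then show False using e(4,5) e'(3) s'js js(2) by simp
    qed
    have st': "state ?B' ?D' js" using al' jsv wjs ir by (auto simp: state_def)
    have u'le: "utility C ?D' w \<le> k" if "w \<in> {k+1..n}" for w
      using aligned_utility_le[OF al', of w] that k_pos by simp
    have w_mono: "k - utility C ?D' w \<le> k - utility C D w" if "w \<in> {k+1..n}" for w
    proof (cases "w = il")
      case True
      then show ?thesis using uil by simp
    next
      case False
      then show ?thesis using uoth[of w] that ir by auto
    qed
    have u1_mono: "utility C ?D' 1 \<le> utility C D 1"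
      using uoth[of 1] uir one_n il1 by (cases "ir = 1") auto
    have "potential ?D' < potential D"
    proof (cases "k < il")
      case True
      have ilw: "il \<in> {k+1..n}" using True il(1) by simp
      have "(\<Sum>w\<in>{k+1..n}. k - utility C ?D' w) < (\<Sum>w\<in>{k+1..n}. k - utility C D w)"
      proof (rule sum_strict_mono_ex1)
        show "\<exists>w\<in>{k+1..n}. k - utility C ?D' w < k - utility C D w"
          using ilw uil u'le[OF ilw] by (intro bexI[of _ il]) auto
      qed (use w_mono in auto)
      then show ?thesis using u1_mono by (simp add: potential_def)
    next
      case False
      then have "ir = 1" using alt by simp
      then have "utility C ?D' 1 < utility C D 1" using uir by simp
      moreover have "(\<Sum>w\<in>{k+1..n}. k - utility C ?D' w) \<le> (\<Sum>w\<in>{k+1..n}. k - utility C D w)"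
        by (rule sum_mono[OF w_mono])
      ultimately show ?thesis by (simp add: potential_def)
    qed
    then show thesis using that[OF set] st' by simp
  qed
qed

end

section \<open>Executions\<close>

definition run :: "('a \<times> 'a \<Rightarrow> 'a \<times> 'a \<Rightarrow> bool) \<Rightarrow> 'a \<times> 'a \<Rightarrow> ('a \<times> 'a) list \<Rightarrow> bool" where
  "run R \<sigma> s \<longleftrightarrow> s \<noteq> [] \<and> hd s = \<sigma> \<and> successively R s \<and> fst (last s) = snd (last s)"

text \<open>The assumption forbids steps from a final pair, so a run ends at the first such
  pair.\<close>

lemma run_iff:
  assumes "\<And>\<tau>. R \<sigma> \<tau> \<Longrightarrow> fst \<sigma> \<noteq> snd \<sigma>"
  shows "run R \<sigma> s \<longleftrightarrow>
    (if fst \<sigma> = snd \<sigma> then s = [\<sigma>] else \<exists>\<tau> s'. s = \<sigma> # s' \<and> R \<sigma> \<tau> \<and> run R \<tau> s')"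
proof (cases s)
  case (Cons x s')
  then show ?thesis using assms by (cases s') (auto simp: run_def)
qed (auto simp: run_def)

lemma scarf_execution_iff_run:
  assumes "\<And>\<tau>. scarf_init n N C \<tau> \<longleftrightarrow> \<tau> = \<sigma>"
  shows "scarf_execution R n N A \<beta> C s \<longleftrightarrow> run (scarf_iteration R n N A \<beta> C) \<sigma> s"
  unfolding scarf_execution_def run_def assms successively_conv_nth by auto

lemma scarf_iteration_not_final:
  "scarf_iteration R n N A \<beta> C \<sigma> \<tau> \<Longrightarrow> fst \<sigma> \<noteq> snd \<sigma>"
  by (cases \<sigma>; cases \<tau>) (simp add: scarf_iteration_def)

lemma scarf_run_iff:
  "run (scarf_iteration R n N A \<beta> C) \<sigma> s \<longleftrightarrow>
    (if fst \<sigma> = snd \<sigma> then s = [\<sigma>]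
     else \<exists>\<tau> s'. s = \<sigma> # s' \<and> scarf_iteration R n N A \<beta> C \<sigma> \<tau> \<and>
       run (scarf_iteration R n N A \<beta> C) \<tau> s')"
  by (rule run_iff) (rule scarf_iteration_not_final)

context marriage
begin

text \<open>The polytope is bounded: raising \<open>jt\<close> adds to the row of its man, so some
  basic column there must decrease.\<close>

lemma candidate_bp_exists:
  assumes st: "state B D jt"
  obtains jl where "candidate n N A bp B jt jl"
proof -
  have al: "aligned B D jt" and jtv: "valid_column jt" using st by (auto simp: state_def)
  note p = alignedD[OF al]
  have BN: "B \<subseteq> {1..N}" and li: "lin_indep_cols n A B" and cB: "card B = n"
    using p(1) by (auto simp: feasible_basis_def)
  have fB: "finite B" using BN by (rule finite_subset) simp
  obtain v where v: "solves n A (\<lambda>_. 0) (insert jt B) v" "v jt = 1"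
    using pivot_direction_exists[OF li fB cB p(6)] by blast
  obtain a b where ab: "edge jt = Valid a b" "a \<in> {1..k}" "b \<in> {1..k}" using jtv by (rule valid_col)
  have "(\<Sum>h\<in>insert jt B. A a h * v h) = 0" using v(1) man_in_n[OF ab(2)] by (simp add: solves_def)
  moreover have "A a jt = 1" using ab(1) by (simp add: matrix_A_def)
  ultimately have sum: "(\<Sum>h\<in>B. A a h * v h) = -1" using fB p(6) v(2) by simp
  have "\<exists>j\<in>B. v j < 0"
  proof (rule ccontr)
    assume "\<not> ?thesis"
    then have "0 \<le> A a h * v h" if "h \<in> B" for h using that A_nonneg[of a h] by auto
    then have "0 \<le> (\<Sum>h\<in>B. A a h * v h)" by (rule sum_nonneg)
    then show False using sum by simp
  qed
  then show thesis using candidate_exists[OF p(1) valid_column_le[OF jtv] p(6) v] that by blast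
qed

abbreviation perturbed_step where
  "perturbed_step \<equiv> scarf_iteration any_candidate n N A bp C"

abbreviation separator_step where
  "separator_step \<equiv> scarf_iteration (separator_rule k mp wp) n N A rhs_b C"

text \<open>Non-degeneracy leaves a single perturbed step; the rule may allow several steps in the
  original system, and the perturbed one is among them.\<close>

lemma state_next:
  assumes st: "state B D jt"
  obtains B' D' where "\<forall>\<tau>. perturbed_step (B, D) \<tau> \<longleftrightarrow> \<tau> = (B', D')" "separator_step (B, D) (B', D')"
    "B' = D' \<or> (\<exists>jt'. state B' D' jt' \<and> potential D' < potential D)"
proof -
  have al: "aligned B D jt" using st by (auto simp: state_def)
  note p = alignedD[OF al]
  have DB: "D - B = {jt}" and ne: "B \<noteq> D" using al by (auto simp: aligned_def)
  obtain jl where cl: "candidate n N A bp B jt jl" using candidate_bp_exists[OF st] .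
  have cu: "candidate n N A bp B jt j \<longleftrightarrow> j = jl" for j
    using nondegenerate_candidate_unique[OF nondegenerate_bp p(1) _ cl p(6), of j] cl by auto
  have cl0: "candidate n N A rhs_b B jt jl"
    using cl feasible_bp_imp_feasible_rhs_b by (simp add: candidate_def)
  obtain i where rule: "separator_rule k mp wp B D jt jl" using state_leaving[OF st cl] by blast
  define B' where "B' = insert jt (B - {jl})"
  show thesis
  proof (cases "jl = 1")
    case True
    have BD: "B' = D" using p(5,8) True by (auto simp: B'_def)
    show thesis
    proof (rule that[of D D])
      show "\<forall>\<tau>. perturbed_step (B, D) \<tau> \<longleftrightarrow> \<tau> = (D, D)"
        using BD ne DB cu by (auto simp: scarf_iteration_def any_candidate_def B'_def)
      show "separator_step (B, D) (D, D)"
        using BD ne DB cl0 rule by (auto simp: scarf_iteration_def B'_def)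
    qed simp
  next
    case False
    obtain js where set: "{j \<in> {1..N} - D. ordinal_basis n N C (insert j (D - {jl}))} = {js}"
      and alt: "(insert jt (B - {jl}) = insert js (D - {jl})) \<or>
        (state (insert jt (B - {jl})) (insert js (D - {jl})) js \<and>
         potential (insert js (D - {jl})) < potential D)"
      using state_step[OF st cl False] .
    have BD: "B' \<noteq> D" using p(3,4) False by (auto simp: B'_def)
    show thesis
    proof (rule that[of B' "insert js (D - {jl})"])
      show "\<forall>\<tau>. perturbed_step (B, D) \<tau> \<longleftrightarrow> \<tau> = (B', insert js (D - {jl}))"
      proof
        fix \<tau>
        show "perturbed_step (B, D) \<tau> \<longleftrightarrow> \<tau> = (B', insert js (D - {jl}))"
          using BD ne DB set unfolding B'_def
          by (cases \<tau>) (simp add: scarf_iteration_def any_candidate_def cu)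
      qed
      show "separator_step (B, D) (B', insert js (D - {jl}))"
        using BD ne DB set cl0 rule unfolding B'_def by (auto simp: scarf_iteration_def)
      show "B' = insert js (D - {jl}) \<or> (\<exists>jt'. state B' (insert js (D - {jl})) jt' \<and>
          potential (insert js (D - {jl})) < potential D)"
        using alt by (auto simp: B'_def)
    qed
  qed
qed

lemma state_run:
  assumes "state B D jt"
  shows "\<exists>s. (\<forall>s'. run perturbed_step (B, D) s' \<longleftrightarrow> s' = s) \<and> run separator_step (B, D) s"
  using assms
proof (induction "potential D" arbitrary: B D jt rule: less_induct)
  case less
  have ne: "B \<noteq> D" using less.prems by (auto simp: state_def aligned_def)
  obtain B' D' where next_p: "\<forall>\<tau>. perturbed_step (B, D) \<tau> \<longleftrightarrow> \<tau> = (B', D')"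
    and next_s: "separator_step (B, D) (B', D')"
    and alt: "B' = D' \<or> (\<exists>jt'. state B' D' jt' \<and> potential D' < potential D)"
    using state_next[OF less.prems] .
  have "\<exists>s. (\<forall>s'. run perturbed_step (B', D') s' \<longleftrightarrow> s' = s) \<and> run separator_step (B', D') s"
    using alt
  proof
    assume "B' = D'"
    then show ?thesis unfolding scarf_run_iff[where \<sigma> = "(B', D')"] by simp
  next
    assume "\<exists>jt'. state B' D' jt' \<and> potential D' < potential D"
    then show ?thesis using less.hyps by blast
  qed
  then obtain s where s: "\<forall>s'. run perturbed_step (B', D') s' \<longleftrightarrow> s' = s"
    "run separator_step (B', D') s" by blast
  have "run perturbed_step (B, D) s' \<longleftrightarrow> s' = (B, D) # s" for s'
    unfolding scarf_run_iff[where \<sigma> = "(B, D)"] using ne next_p s(1) by simp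
  moreover have "run separator_step (B, D) ((B, D) # s)"
    unfolding scarf_run_iff[where \<sigma> = "(B, D)"] using ne next_s s(2) by auto
  ultimately show ?case by blast
qed

section \<open>The initial pair and the whole execution\<close>

lemma initial_feasible: "feasible_basis n N A bp {1..n}"
proof -
  have row: "(\<Sum>j\<in>{1..n}. A i j * y j) = y i" if i: "i \<in> {1..n}" for i y
  proof -
    have "(\<Sum>j\<in>{1..n}. A i j * y j) = (\<Sum>j\<in>{1..n}. if j = i then y j else 0)"
      by (rule sum.cong) (auto simp: matrix_A_def edge_loop)
    then show ?thesis using i by simp
  qed
  show ?thesis
  proof (rule feasible_basisI)
    show "lin_indep_cols n A {1..n}" unfolding lin_indep_cols_def using row by simp
    show "solves n A bp {1..n} (\<lambda>j. if j \<in> {1..n} then bp j else 0)"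
      unfolding solves_def using row[of _ "\<lambda>j. if j \<in> {1..n} then bp j else 0"] by simp
  qed (use n_le_N bp_pos in \<open>auto simp: less_imp_le\<close>)
qed

text \<open>The first man dislikes \<open>j0\<close>, which maximality makes a block for all valid
  columns; each loop is blocked in its own row, where its entry is 0.\<close>

lemma initial_state:
  assumes j0: "valid_column j0" "\<And>j. valid_column j \<Longrightarrow> C 1 j \<le> C 1 j0"
  shows "state {1..n} (insert j0 {2..n}) j0"
proof -
  let ?D = "insert j0 {2..n}"
  have j0N: "j0 \<in> {1..N}" and j0n: "j0 \<notin> {1..n}" using j0(1) by (auto simp: valid_column_def)
  have u1: "utility C ?D 1 = C 1 j0"
  proof (rule utility_eqI)
    fix h assume h: "h \<in> ?D"
    show "C 1 j0 \<le> C 1 h"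
    proof (cases "h = j0")
      case False
      then have "h \<in> {1..n}" "1 \<noteq> h" using h by auto
      then show ?thesis using C_loop_gt[of h 1] C_valid_le[OF one_n j0(1)] by simp
    qed simp
  qed auto
  have DN: "?D \<subseteq> {1..N}" using j0N n_le_N by auto
  have ob: "ordinal_basis n N C ?D"
    unfolding ordinal_basis_def
  proof (intro conjI ballI)
    show "card ?D = n" using j0n n_ge2 by simp
    fix h assume h: "h \<in> {1..N}"
    show "\<exists>i\<in>{1..n}. C i h \<le> utility C ?D i"
    proof (cases "valid_column h")
      case True
      then have "C 1 h \<le> utility C ?D 1" using j0(2) u1 by simp
      then show ?thesis using one_n by blast
    next
      case False
      then have hn: "h \<in> {1..n}" using not_valid_column[OF h] by blast
      then have "C h h \<le> utility C ?D h" using C_loop_self by simp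
      then show ?thesis using hn by blast
    qed
  qed (rule DN)
  have "{1..n} - ?D = {1}" "?D - {1..n} = {j0}" using j0n n_ge2 by auto
  then have "aligned {1..n} ?D j0" using initial_feasible ob by (simp add: aligned_def)
  moreover have "worst C ?D 1 = j0" by (rule worst_eqI[OF one_n DN _ u1]) simp
  ultimately show ?thesis using j0(1) one_k by (auto simp: state_def)
qed

lemma initial_unique:
  obtains j0 where "state {1..n} (insert j0 {2..n}) j0"
    "\<forall>\<tau>. scarf_init n N C \<tau> \<longleftrightarrow> \<tau> = ({1..n}, insert j0 {2..n})"
proof -
  let ?V = "{n<..N}"
  have V: "finite (C 1 ` ?V)" "C 1 ` ?V \<noteq> {}" using k_pos by (auto simp: N_def)
  then have "Max (C 1 ` ?V) \<in> C 1 ` ?V" by (rule Max_in)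
  then obtain j0 where j0: "j0 \<in> ?V" "C 1 j0 = Max (C 1 ` ?V)" by auto
  have mx: "C 1 j \<le> C 1 j0" if "j \<in> ?V" for j using j0(2) V that by simp
  have uniq: "j = j0" if j: "j \<in> ?V" "\<forall>h\<in>?V. C 1 h \<le> C 1 j" for j
  proof (rule C_eq_imp_eq[OF one_n])
    show "C 1 j = C 1 j0" using mx[OF j(1)] j(2) j0(1) by (simp add: order_antisym)
  qed (use j j0 in auto)
  show thesis
  proof (rule that[of j0])
    show "state {1..n} (insert j0 {2..n}) j0"
      by (rule initial_state) (use j0(1) mx in \<open>auto simp: valid_column_def\<close>)
    show "\<forall>\<tau>. scarf_init n N C \<tau> \<longleftrightarrow> \<tau> = ({1..n}, insert j0 {2..n})"
    proof
      fix \<tau> :: "nat set \<times> nat set"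
      obtain B D where \<tau>: "\<tau> = (B, D)" by (cases \<tau>)
      have "(\<exists>j\<in>?V. (\<forall>h\<in>?V. C 1 h \<le> C 1 j) \<and> D = insert j {2..n}) \<longleftrightarrow> D = insert j0 {2..n}"
        using uniq mx j0(1) by metis
      then show "scarf_init n N C \<tau> \<longleftrightarrow> \<tau> = ({1..n}, insert j0 {2..n})"
        unfolding scarf_init_def \<tau> by simp
    qed
  qed
qed

lemma unique_execution_follows_separator_rule:
  "\<exists>s. (\<forall>s'. scarf_execution any_candidate n N A bp C s' \<longleftrightarrow> s' = s) \<and>
       scarf_execution (separator_rule k mp wp) n N A rhs_b C s"
proof -
  obtain j0 where st: "state {1..n} (insert j0 {2..n}) j0"
    and init: "\<forall>\<tau>. scarf_init n N C \<tau> \<longleftrightarrow> \<tau> = ({1..n}, insert j0 {2..n})"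
    using initial_unique .
  show ?thesis
    using state_run[OF st] scarf_execution_iff_run[OF init[rule_format]] by simp
qed

end

theorem theorem8:
  fixes k n N :: nat
    and mp wp :: "nat \<Rightarrow> nat list"
    and A :: "nat \<Rightarrow> nat \<Rightarrow> real"
    and C :: "nat \<Rightarrow> nat \<Rightarrow> nat"
  assumes "k \<ge> 1"
    and "complete_marriage_instance k mp wp"
    and "n = 2 * k" and "N = n + k^2"
    and "A = matrix_A k mp" and "C = matrix_C k mp wp"
  shows "\<exists>\<epsilon>::real. \<epsilon> > 0 \<and> \<epsilon> \<in> \<rat> \<and>
    nondegenerate n N A (\<lambda>i. rhs_b i + perturbation k \<epsilon> i) \<and>
    (\<exists>s. (\<forall>s'. scarf_execution any_candidate n N A (\<lambda>i. rhs_b i + perturbation k \<epsilon> i) C s'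
                 \<longleftrightarrow> s' = s) \<and>
         scarf_execution (separator_rule k mp wp) n N A rhs_b C s)"
proof -
  interpret M: marriage k mp wp using assms(1,2) by unfold_locales
  have n: "M.n = n" and N: "M.N = N" using assms(3,4) by (simp_all add: M.n_def M.N_def)
  have bp: "M.bp = (\<lambda>i. rhs_b i + perturbation k M.eps i)" by (simp add: M.bp_def)
  have "M.eps \<in> \<rat>" by (simp add: M.eps_def)
  moreover have "nondegenerate n N A (\<lambda>i. rhs_b i + perturbation k M.eps i)"
    using M.nondegenerate_bp unfolding n N bp assms(5) .
  ultimately show ?thesis
    using M.eps_bounds(1) M.unique_execution_follows_separator_rule
    unfolding n N bp assms(5,6) by blast
qed

end
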